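(* There exist polyhedral normed spaces whose unit sphere is not covered by true faces of the unit ball. More specifically: (a) there exists a (K)-polyhedral normed space $X$ with property ($\Delta$) such that $S_X$ is not covered by the true faces of $B_X$ (i.e. some point of $S_X$ belongs to no true face of $B_X$); (b) there exists a (V)-polyhedral normed space $X$ such that $B_X$ does not have any algebraic true face; (c) there exists a (K)-polyhedral normed space $X$ such that the set of strongly exposed points of $B_X$ is dense in $S_X$.
   Context: All normed spaces are real. For a normed space $X$, $B_X$ and $S_X$ denote its closed unit ball and unit sphere, and $X^*$ its topological dual. $\operatorname{ext} C$ is the set of extreme points of a convex set $C$. For $x\in S_X$ let $\mathcal D(x)=\{f\in S_{X^*}: f(x)=1\}$. Property ($\Delta$): for every $x\in S_X$ the set $\operatorname{ext}\mathcal D(x)$ is finite. (K)-polyhedral (also simply called polyhedral): the unit ball of every finite-dimensional subspace of $X$ is a polytope (the convex hull of finitely many points). (V)-polyhedral: $\sup\{f(x): f\in \operatorname{ext}B_{X^*}\setminus\mathcal D(x)\}<1$ for every $x\in S_X$. True faces: let $H$ be a supporting hyperplane for $B_X$, i.e. $H=f^{-1}(1)$ with $f\in S_{X^*}$ and $H\cap B_X\neq\emptyset$. The face $F=B_X\cap H$ is a true face if its interior relative to $H$ is non-empty; it is an algebraic true face if its algebraic interior relative to $H$ is non-empty, where $p\in F$ is in the algebraic interior of $F$ relative to $H$ if for every $q\in H$ there is $\delta>0$ with $p+t(q-p)\in F$ for all $|t|\le\delta$. A point $x\in C$ is a strongly exposed point of a convex set $C$ if there is $f\in X^*$ with $f(y)<f(x)$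 for all $y\in C$, $y\neq x$, and such that $y_n\to x$ in norm for every sequence $(y_n)$ in $C$ with $f(y_n)\to f(x)$. *)

theory Defs
  imports "HOL-Analysis.Analysis" "HOL-Library.Function_Algebras"
begin

text \<open>Pointwise scalar multiplication; together with the pointwise operations of
  \<^theory>\<open>HOL-Library.Function_Algebras\<close> it makes both the ambient space of real sequences and the
  space of real functionals real vector spaces.\<close>

instantiation "fun" :: (type, scaleR) scaleR
begin

definition scaleR_fun :: "real \<Rightarrow> ('a \<Rightarrow> 'b) \<Rightarrow> 'a \<Rightarrow> 'b"
  where "scaleR_fun c f = (\<lambda>x. c *\<^sub>R f x)"

instance ..

end

instance "fun" :: (type, real_vector) real_vector
  by standard (auto simp: scaleR_fun_def plus_fun_def fun_eq_iff scaleR_add_right scaleR_add_left)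

text \<open>A normed space is a linear subspace \<open>V\<close> of some real vector space, with a norm \<open>N\<close> on \<open>V\<close>.
  Values of \<open>N\<close> outside \<open>V\<close> are irrelevant.\<close>

locale normed_space =
  fixes V :: "'a::real_vector set" and N :: "'a \<Rightarrow> real"
  assumes subspace_carrier: "subspace V"
    and norm_eq_0_iff: "x \<in> V \<Longrightarrow> N x = 0 \<longleftrightarrow> x = 0"
    and norm_triangle: "\<lbrakk>x \<in> V; y \<in> V\<rbrakk> \<Longrightarrow> N (x + y) \<le> N x + N y"
    and norm_scaleR: "x \<in> V \<Longrightarrow> N (c *\<^sub>R x) = \<bar>c\<bar> * N x"

text \<open>The guard is needed because \<^locale>\<open>Metric_space\<close> asks for symmetry and nonnegativity on
  the whole type.\<close>

definition norm_dist :: "'a::real_vector set \<Rightarrow> ('a \<Rightarrow> real) \<Rightarrow> 'a \<Rightarrow> 'a \<Rightarrow> real"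
  where "norm_dist V N x y = (if x \<in> V \<and> y \<in> V then N (x - y) else 0)"

lemma (in normed_space) Metric_space_norm_dist: "Metric_space V (norm_dist V N)"
proof -
  have diff: "x - y \<in> V" if "x \<in> V" "y \<in> V" for x y
    using that subspace_carrier by (simp add: subspace_diff)
  have swap: "N (x - y) = N (y - x)" if "x \<in> V" "y \<in> V" for x y
    using norm_scaleR[of "y - x" "-1"] diff that by simp
  have zero: "N (x - y) = 0 \<longleftrightarrow> x = y" if "x \<in> V" "y \<in> V" for x y
    using norm_eq_0_iff[OF diff[OF that]] by simp
  have triangle: "N (x - z) \<le> N (x - y) + N (y - z)" if "x \<in> V" "y \<in> V" "z \<in> V" for x y z
    using norm_triangle[of "x - y" "y - z"] diff that by simp
  have nonneg: "0 \<le> N (x - y)" if "x \<in> V" "y \<in> V" for x y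
    using triangle[of x y x] zero[of x x] swap[of x y] that by simp
  show ?thesis
    by unfold_locales (auto simp: norm_dist_def zero triangle nonneg swap)
qed

definition norm_topology :: "'a::real_vector set \<Rightarrow> ('a \<Rightarrow> real) \<Rightarrow> 'a topology"
  where "norm_topology V N = Metric_space.mtopology V (norm_dist V N)"

definition unit_ball :: "'a::real_vector set \<Rightarrow> ('a \<Rightarrow> real) \<Rightarrow> 'a set"
  where "unit_ball V N = {x \<in> V. N x \<le> 1}"

definition unit_sphere :: "'a::real_vector set \<Rightarrow> ('a \<Rightarrow> real) \<Rightarrow> 'a set"
  where "unit_sphere V N = {x \<in> V. N x = 1}"

text \<open>A functional on \<open>V\<close> is extended by \<open>0\<close> outside \<open>V\<close>, so that distinct elements of the dual
  are distinct functions and the dual is a linear subspace of the functions \<open>'a \<Rightarrow> real\<close>.\<close>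

definition topological_dual :: "'a::real_vector set \<Rightarrow> ('a \<Rightarrow> real) \<Rightarrow> ('a \<Rightarrow> real) set"
  where "topological_dual V N =
    {f. (\<forall>x\<in>V. \<forall>y\<in>V. f (x + y) = f x + f y) \<and>
        (\<forall>c. \<forall>x\<in>V. f (c *\<^sub>R x) = c * f x) \<and>
        (\<exists>K. \<forall>x\<in>V. \<bar>f x\<bar> \<le> K * N x) \<and>
        (\<forall>x. x \<notin> V \<longrightarrow> f x = 0)}"

definition dual_norm :: "'a::real_vector set \<Rightarrow> ('a \<Rightarrow> real) \<Rightarrow> ('a \<Rightarrow> real) \<Rightarrow> real"
  where "dual_norm V N f = (SUP x \<in> unit_ball V N. \<bar>f x\<bar>)"

definition dual_ball :: "'a::real_vector set \<Rightarrow> ('a \<Rightarrow> real) \<Rightarrow> ('a \<Rightarrow> real) set"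
  where "dual_ball V N = unit_ball (topological_dual V N) (dual_norm V N)"

definition dual_sphere :: "'a::real_vector set \<Rightarrow> ('a \<Rightarrow> real) \<Rightarrow> ('a \<Rightarrow> real) set"
  where "dual_sphere V N = unit_sphere (topological_dual V N) (dual_norm V N)"

definition norming_functionals :: "'a::real_vector set \<Rightarrow> ('a \<Rightarrow> real) \<Rightarrow> 'a \<Rightarrow> ('a \<Rightarrow> real) set"
  where "norming_functionals V N x = {f \<in> dual_sphere V N. f x = 1}"

definition extreme_points :: "'a::real_vector set \<Rightarrow> 'a set"
  where "extreme_points C = {x. x extreme_point_of C}"

definition property_Delta :: "'a::real_vector set \<Rightarrow> ('a \<Rightarrow> real) \<Rightarrow> bool"
  where "property_Delta V N \<longleftrightarrow>
    (\<forall>x \<in> unit_sphere V N. finite (extreme_points (norming_functionals V N x)))"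

definition K_polyhedral :: "'a::real_vector set \<Rightarrow> ('a \<Rightarrow> real) \<Rightarrow> bool"
  where "K_polyhedral V N \<longleftrightarrow>
    (\<forall>W. subspace W \<and> W \<subseteq> V \<and> (\<exists>B. finite B \<and> span B = W) \<longrightarrow> polytope (unit_ball W N))"

text \<open>The supremum is over a nonempty set bounded above by \<open>1\<close>: by Krein--Milman
  \<open>norming_functionals V N x\<close> has an extreme point \<open>f\<close>, it is extreme in the dual ball,
  and so is \<open>- f\<close>, which is not norming at \<open>x\<close>.\<close>

definition V_polyhedral :: "'a::real_vector set \<Rightarrow> ('a \<Rightarrow> real) \<Rightarrow> bool"
  where "V_polyhedral V N \<longleftrightarrow>
    (\<forall>x \<in> unit_sphere V N.
      (SUP f \<in> extreme_points (dual_ball V N) - norming_functionals V N x. f x) < 1)"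

definition supporting_hyperplanes :: "'a::real_vector set \<Rightarrow> ('a \<Rightarrow> real) \<Rightarrow> 'a set set"
  where "supporting_hyperplanes V N =
    {H. \<exists>f \<in> dual_sphere V N. H = {x \<in> V. f x = 1} \<and> H \<inter> unit_ball V N \<noteq> {}}"

definition algebraic_interior_rel :: "'a::real_vector set \<Rightarrow> 'a set \<Rightarrow> 'a set"
  where "algebraic_interior_rel H F =
    {p \<in> F. \<forall>q\<in>H. \<exists>\<delta>>0. \<forall>t::real. \<bar>t\<bar> \<le> \<delta> \<longrightarrow> p + t *\<^sub>R (q - p) \<in> F}"

definition true_faces :: "'a::real_vector set \<Rightarrow> ('a \<Rightarrow> real) \<Rightarrow> 'a set set"
  where "true_faces V N =
    {F. \<exists>H \<in> supporting_hyperplanes V N. F = unit_ball V N \<inter> H \<and>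
        subtopology (norm_topology V N) H interior_of F \<noteq> {}}"

definition algebraic_true_faces :: "'a::real_vector set \<Rightarrow> ('a \<Rightarrow> real) \<Rightarrow> 'a set set"
  where "algebraic_true_faces V N =
    {F. \<exists>H \<in> supporting_hyperplanes V N. F = unit_ball V N \<inter> H \<and>
        algebraic_interior_rel H F \<noteq> {}}"

definition strongly_exposed_points ::
    "'a::real_vector set \<Rightarrow> ('a \<Rightarrow> real) \<Rightarrow> 'a set \<Rightarrow> 'a set"
  where "strongly_exposed_points V N C =
    {x \<in> C. \<exists>f \<in> topological_dual V N.
        (\<forall>y\<in>C. y \<noteq> x \<longrightarrow> f y < f x) \<and>
        (\<forall>y. (\<forall>n. y n \<in> C) \<and> (\<lambda>n. f (y n)) \<longlonglongrightarrow> f x \<longrightarrow>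
             limitin (norm_topology V N) y x sequentially)}"

end

theory Submission
  imports Defs
begin

text \<open>
  The three parts are witnessed by three different spaces of real sequences, all of countable
  algebraic dimension. Such a space is the union of an increasing chain of finite-dimensional
  subspaces: its unit ball can be a polytope on each of them and still degenerate along the chain.

  \<^item> For (a), let \<open>u = (1, 1 - 1/2, 1 - 1/4, 1 - 1/8, \<dots>)\<close> and take all sequences that eventually
    coincide with a multiple of \<open>u\<close>, with the supremum norm. On a finite-dimensional subspace
    finitely many coordinates determine the norm, which gives polyhedrality. A point \<open>x\<close> of the
    sphere can be moved by \<open>2\<^sup>-\<^sup>k\<close> in each late coordinate \<open>k\<close> without leaving the ball, hence
    functionals norming at \<open>x\<close> vanish on late unit vectors
    (\<open>norming_functional_vanishes\<close>), live on a finite-dimensional quotient, and are cut out there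
    by finitely many inequalities; this is property \<open>\<Delta>\<close>. At \<open>u\<close> the only norming functional is
    the coordinate \<open>0\<close>. In its face every point has late coordinates \<open>1 - 2\<^sup>-\<^sup>k\<close>, so an
    arbitrarily small push in a late coordinate leaves the ball: the face has empty interior
    (\<open>profile_not_in_true_face\<close>).

  \<^item> For (b), take the finitely supported sequences with the sum norm. Extreme functionals are sign
    sequences, and a finitely supported point sees only finitely many sign patterns, so the
    supremum is the maximum of finitely many numbers below \<open>1\<close> (\<open>V_polyhedral_l1\<close>). If \<open>p\<close> lies
    in the face of \<open>f\<close> and \<open>n\<close> is outside the support of \<open>p\<close>, then \<open>d = e\<^sub>n - f(e\<^sub>n) p\<close> is
    parallel to the hyperplane and \<open>p + t d\<close> has norm \<open>\<bar>1 - t f(e\<^sub>n)\<bar> + \<bar>t\<bar>\<close>, which exceeds \<open>1\<close> for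
    \<open>t\<close> or for \<open>-t\<close>, however small \<open>t \<noteq> 0\<close> is (\<open>no_algebraic_true_faces_l1\<close>).

  \<^item> For (c), the unit ball on the finitely supported sequences is an increasing union of polytopes
    \<open>B\<^sub>m\<close>, where \<open>B\<^sub>m\<^sub>+\<^sub>1\<close> is the convex hull of \<open>B\<^sub>m\<close> with \<open>\<plusminus>e\<^sub>m\<close> and \<open>\<plusminus>v\<^sub>m\<close> for
    \<open>v\<^sub>m = (1 - \<epsilon>\<^sub>m/2) q\<^sub>m + \<epsilon>\<^sub>m e\<^sub>m\<close>. Here \<open>q\<^sub>m\<close> runs through the normalized rational vectors, each of them
    infinitely often, and \<open>\<epsilon>\<^sub>m\<close> tends to \<open>0\<close>, so the \<open>v\<^sub>m\<close> come close to every point of the sphere. If \<open>g\<close>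
    supports the ball \<open>B\<^sub>n\<close> at \<open>q\<^sub>n\<close>, then \<open>f = (g + e\<^sub>n\<^sup>*) / (1 + \<epsilon>\<^sub>n/2)\<close> exposes \<open>v\<^sub>n\<close> in \<open>B\<^sub>n\<^sub>+\<^sub>1\<close> with
    an estimate \<open>\<parallel>y - v\<^sub>n\<parallel> \<le> C (1 - f y)\<close>. The factor \<open>1 - \<epsilon>\<^sub>m/2\<close> is there to keep this estimate
    alive with the same \<open>C\<close> in all later steps: the new vertex \<open>v\<^sub>m\<close> is farther from \<open>v\<^sub>n\<close> than
    \<open>q\<^sub>m\<close> by at most \<open>3\<epsilon>\<^sub>m/2\<close>, but the shrinking makes \<open>1 - f\<close> grow by a comparable amount
    (\<open>vertices_bound\<close>). Thus all these \<open>v\<^sub>n\<close> are strongly exposed.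
    A true face would contain a strongly exposed point in its relative interior, as the midpoint
    of a segment in the ball, which is absurd
    (\<open>true_faces_empty_if_strongly_exposed_dense\<close>).
\<close>

section \<open>Real functions as vectors\<close>

lemma scaleR_fun_apply [simp]: "(c *\<^sub>R f) x = c *\<^sub>R f x"
  by (simp add: scaleR_fun_def)

lemma sum_fun_apply: "(\<Sum>i\<in>A. F i) x = (\<Sum>i\<in>A. F i x)"
  for F :: "'i \<Rightarrow> 'a \<Rightarrow> 'b::comm_monoid_add"
  by (induction A rule: infinite_finite_induct) auto

lemma linear_eval: "linear (\<lambda>f :: 'a \<Rightarrow> real. f x)"
  by (rule linearI) auto

section \<open>Finite systems of linear inequalities\<close>

lemma extreme_point_of_perturb:
  fixes x :: "'a::real_vector"
  assumes "x extreme_point_of C" "x + d \<in> C" "x - d \<in> C"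
  shows "d = 0"
proof (rule ccontr)
  assume "d \<noteq> 0"
  have "x = (1 - 1/2) *\<^sub>R (x + d) + (1/2::real) *\<^sub>R (x - d)"
    by (simp add: scaleR_add_right scaleR_diff_right flip: scaleR_add_left)
  moreover have "x + d \<noteq> x - d"
  proof
    assume "x + d = x - d"
    then have "(2::real) *\<^sub>R d = 0" by (simp add: scaleR_2 algebra_simps)
    with \<open>d \<noteq> 0\<close> show False by simp
  qed
  ultimately have "x \<in> open_segment (x + d) (x - d)"
    unfolding in_segment by (metis half_gt_zero_iff less_numeral_extra(1) field_sum_of_halves
        less_add_same_cancel1)
  with assms show False by (auto simp: extreme_point_of_def)
qed

lemma extreme_point_ofI:
  fixes x :: "'a::real_vector"
  assumes "x \<in> C"
    and "\<And>a b u. \<lbrakk>a \<in> C; b \<in> C; 0 < u; u < 1; x = (1 - u) *\<^sub>R a + u *\<^sub>R b\<rbrakk> \<Longrightarrow> a = b"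
  shows "x extreme_point_of C"
  using assms unfolding extreme_point_of_def in_segment by blast

definition solutions ::
    "'a::real_vector set \<Rightarrow> 'i set \<Rightarrow> ('i \<Rightarrow> 'a \<Rightarrow> real) \<Rightarrow> ('i \<Rightarrow> real) \<Rightarrow> 'a set"
  where "solutions Y I \<phi> b = {x \<in> Y. \<forall>i\<in>I. \<phi> i x \<le> b i}"

text \<open>A slack inequality tolerates a small change in either direction; a tight one tolerates none, hence
  the condition on \<open>c\<close>. There are only finitely many, so one \<open>t\<close> serves them all.\<close>

lemma inequalities_near:
  fixes s c b :: "'i \<Rightarrow> real"
  assumes "finite I" and "\<And>i. i \<in> I \<Longrightarrow> s i \<le> b i" and "\<And>i. \<lbrakk>i \<in> I; s i = b i\<rbrakk> \<Longrightarrow> c i = 0"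
  shows "\<exists>t>0. \<forall>i\<in>I. s i + t * c i \<le> b i \<and> s i - t * c i \<le> b i"
  using assms
proof (induction I rule: finite_induct)
  case empty
  show ?case by (rule exI[of _ 1]) simp
next
  case (insert j I)
  then obtain t where t: "t > 0" "\<forall>i\<in>I. s i + t * c i \<le> b i \<and> s i - t * c i \<le> b i"
    by (metis insertCI)
  show ?case
  proof (cases "c j = 0")
    case True
    with t insert.prems show ?thesis by (intro exI[of _ t]) auto
  next
    case False
    with insert.prems have j: "s j < b j" by (metis insertI1 less_eq_real_def)
    define t' where "t' = min t ((b j - s j) / \<bar>c j\<bar>)"
    have t': "0 < t'" "t' \<le> t" using t(1) j False by (auto simp: t'_def)
    have "t' * \<bar>c j\<bar> \<le> (b j - s j) / \<bar>c j\<bar> * \<bar>c j\<bar>"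
      by (intro mult_right_mono) (auto simp: t'_def)
    then have "\<bar>t' * c j\<bar> \<le> b j - s j" using False t'(1) by (simp add: abs_mult)
    moreover have "s i + t' * c i \<le> b i \<and> s i - t' * c i \<le> b i" if "i \<in> I" for i
    proof -
      have "\<bar>t' * c i\<bar> \<le> \<bar>t * c i\<bar>" using t' t(1) by (auto simp: abs_mult intro: mult_right_mono)
      also have "\<dots> \<le> b i - s i" using t(2) that by (auto simp: abs_le_iff)
      finally show ?thesis by (auto simp: abs_le_iff)
    qed
    ultimately show ?thesis using t' by (intro exI[of _ t']) (auto simp: abs_le_iff)
  qed
qed

text \<open>A solution is extreme exactly when its tight inequalities leave it no direction to move in:
  the slack ones can be ignored for small movements.\<close>

lemma extreme_point_of_solutions_iff:
  assumes Y: "subspace Y" and fin: "finite I" and lin: "\<And>i. i \<in> I \<Longrightarrow> linear (\<phi> i)"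
  shows "x extreme_point_of solutions Y I \<phi> b \<longleftrightarrow> x \<in> solutions Y I \<phi> b \<and>
    (\<forall>d\<in>Y. (\<forall>i\<in>I. \<phi> i x = b i \<longrightarrow> \<phi> i d = 0) \<longrightarrow> d = 0)"
proof (intro iffI conjI ballI impI)
  let ?C = "solutions Y I \<phi> b"
  assume x: "x extreme_point_of ?C"
  then show xC: "x \<in> ?C" by (simp add: extreme_point_of_def)
  fix d assume d: "d \<in> Y" "\<forall>i\<in>I. \<phi> i x = b i \<longrightarrow> \<phi> i d = 0"
  have "\<exists>t>0. \<forall>i\<in>I. \<phi> i x + t * \<phi> i d \<le> b i \<and> \<phi> i x - t * \<phi> i d \<le> b i"
    using xC d fin by (intro inequalities_near) (auto simp: solutions_def)
  then obtain t where t: "t > 0"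
    "\<And>i. i \<in> I \<Longrightarrow> \<phi> i x + t * \<phi> i d \<le> b i \<and> \<phi> i x - t * \<phi> i d \<le> b i" by blast
  have "x + t *\<^sub>R d \<in> ?C" "x - t *\<^sub>R d \<in> ?C"
    using xC d(1) t lin Y
    by (auto simp: solutions_def linear_add linear_diff linear_scale subspace_add subspace_diff
        subspace_scale)
  from extreme_point_of_perturb[OF x this] \<open>t > 0\<close> show "d = 0" by simp
next
  let ?C = "solutions Y I \<phi> b"
  assume x: "x \<in> ?C \<and> (\<forall>d\<in>Y. (\<forall>i\<in>I. \<phi> i x = b i \<longrightarrow> \<phi> i d = 0) \<longrightarrow> d = 0)"
  show "x extreme_point_of ?C"
  proof (rule extreme_point_ofI)
    fix a c u
    assume ac: "a \<in> ?C" "c \<in> ?C" and u: "0 < u" "u < 1" and xeq: "x = (1 - u) *\<^sub>R a + u *\<^sub>R c"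
    have "\<phi> i (a - c) = 0" if i: "i \<in> I" "\<phi> i x = b i" for i
    proof -
      have eq: "b i = (1 - u) * \<phi> i a + u * \<phi> i c"
        using lin[OF i(1)] i(2) by (simp add: xeq linear_add linear_scale)
      have le: "\<phi> i a \<le> b i" "\<phi> i c \<le> b i" using ac i(1) by (auto simp: solutions_def)
      have "(1 - u) * (b i - \<phi> i a) + u * (b i - \<phi> i c) = 0" using eq by (simp add: algebra_simps)
      then have "(1 - u) * (b i - \<phi> i a) = 0" "u * (b i - \<phi> i c) = 0"
        using le u by (simp_all add: add_nonneg_eq_0_iff)
      with u have "\<phi> i a = b i" "\<phi> i c = b i" by auto
      then show ?thesis using lin[OF i(1)] by (simp add: linear_diff)
    qed
    moreover have "a - c \<in> Y" using ac Y by (auto simp: solutions_def subspace_diff)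
    ultimately have "a - c = 0" using x by blast
    then show "a = c" by simp
  qed (use x in blast)
qed

text \<open>Two extreme points with the same tight inequalities differ by a direction in which all these
  inequalities are constant, so they coincide. Hence there are at most as many extreme points as
  subsets of \<open>I\<close>.\<close>

lemma finite_extreme_points_solutions:
  assumes Y: "subspace Y" and fin: "finite I" and lin: "\<And>i. i \<in> I \<Longrightarrow> linear (\<phi> i)"
  shows "finite (extreme_points (solutions Y I \<phi> b))"
proof -
  let ?E = "extreme_points (solutions Y I \<phi> b)"
  define T where "T x = {i \<in> I. \<phi> i x = b i}" for x
  have "inj_on T ?E"
  proof (rule inj_onI)
    fix x y assume x: "x \<in> ?E" and y: "y \<in> ?E" and "T x = T y"
    then have "\<phi> i x = b i \<longleftrightarrow> \<phi> i y = b i" if "i \<in> I" for i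
      using that unfolding T_def by blast
    then have "\<forall>i\<in>I. \<phi> i x = b i \<longrightarrow> \<phi> i (x - y) = 0"
      using lin by (simp add: linear_diff)
    moreover have "x - y \<in> Y"
      using x y Y by (auto simp: extreme_points_def extreme_point_of_def solutions_def subspace_diff)
    ultimately show "x = y"
      using x extreme_point_of_solutions_iff[where x = x and b = b and \<phi> = \<phi>, OF Y fin lin] unfolding extreme_points_def by auto
  qed
  moreover have "finite (T ` ?E)"
    by (rule finite_subset[of _ "Pow I"]) (use fin in \<open>auto simp: T_def\<close>)
  ultimately show ?thesis using finite_imageD by blast
qed

text \<open>The first inequality to become tight along the ray gives \<open>t\<close>.\<close>

lemma solutions_first_exit:
  assumes Y: "subspace Y" and fin: "finite I" and lin: "\<And>i. i \<in> I \<Longrightarrow> linear (\<phi> i)"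
    and x: "x \<in> solutions Y I \<phi> b" and d: "d \<in> Y" "\<exists>i\<in>I. \<phi> i d > 0"
  obtains t j where "t \<ge> 0" "x + t *\<^sub>R d \<in> solutions Y I \<phi> b" "j \<in> I" "\<phi> j d > 0"
    "\<phi> j (x + t *\<^sub>R d) = b j"
proof -
  define J where "J = {i \<in> I. \<phi> i d > 0}"
  define r where "r i = (b i - \<phi> i x) / \<phi> i d" for i
  have J: "finite J" "J \<noteq> {}" using fin d(2) by (auto simp: J_def)
  define t where "t = Min (r ` J)"
  have "t \<in> r ` J" unfolding t_def using J by (intro Min_in) auto
  then obtain j where j: "j \<in> J" "t = r j" by auto
  have t0: "t \<ge> 0" using j x by (auto simp: r_def J_def solutions_def)
  have "\<phi> i x + t * \<phi> i d \<le> b i" if "i \<in> I" for i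
  proof (cases "\<phi> i d > 0")
    case True
    then have "t \<le> r i" using that J by (auto simp: t_def J_def)
    then show ?thesis using True by (simp add: r_def field_simps)
  next
    case False
    then have "t * \<phi> i d \<le> 0" using t0 by (simp add: mult_nonneg_nonpos)
    then show ?thesis using x that by (force simp: solutions_def)
  qed
  then have "x + t *\<^sub>R d \<in> solutions Y I \<phi> b"
    using x d(1) lin Y by (auto simp: solutions_def linear_add linear_scale subspace_add subspace_scale)
  moreover have "\<phi> j (x + t *\<^sub>R d) = b j"
    using j lin by (auto simp: J_def r_def linear_add linear_scale)
  ultimately show thesis using that t0 j(1) by (auto simp: J_def)
qed

text \<open>The easy half of the Minkowski--Weyl theorem, in any real vector space. A solution that is not
  extreme can be moved in a direction that keeps the tight inequalities tight, and \<open>bounded\<close> forces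
  it to hit a new inequality both forwards and backwards. So it lies between two solutions with
  fewer slack inequalities, and induction on the number of slack inequalities applies.\<close>

lemma polytope_solutions:
  assumes Y: "subspace Y" and fin: "finite I" and lin: "\<And>i. i \<in> I \<Longrightarrow> linear (\<phi> i)"
    and bounded: "\<And>d. \<lbrakk>d \<in> Y; d \<noteq> 0\<rbrakk> \<Longrightarrow> \<exists>i\<in>I. \<phi> i d > 0"
  shows "polytope (solutions Y I \<phi> b)"
proof -
  let ?C = "solutions Y I \<phi> b"
  define E where "E = extreme_points ?C"
  have convex: "convex ?C"
  proof (rule convexI)
    fix x y and u v :: real
    assume xy: "x \<in> ?C" "y \<in> ?C" and uv: "0 \<le> u" "0 \<le> v" "u + v = 1"
    have "u * \<phi> i x + v * \<phi> i y \<le> b i" if "i \<in> I" for i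
      using xy uv that by (intro convex_bound_le) (auto simp: solutions_def)
    then show "u *\<^sub>R x + v *\<^sub>R y \<in> ?C"
      using xy lin Y by (auto simp: solutions_def linear_add linear_scale subspace_add subspace_scale)
  qed
  have "x \<in> convex hull E" if "x \<in> ?C" for x
    using that
  proof (induction "card {i \<in> I. \<phi> i x \<noteq> b i}" arbitrary: x rule: less_induct)
    case less
    show ?case
    proof (cases "x \<in> E")
      case True
      then show ?thesis by (rule hull_inc)
    next
      case False
      then obtain d where d: "d \<in> Y" "\<forall>i\<in>I. \<phi> i x = b i \<longrightarrow> \<phi> i d = 0" "d \<noteq> 0"
        using extreme_point_of_solutions_iff[where x = x and b = b and \<phi> = \<phi>, OF Y fin lin] less.prems
        unfolding E_def extreme_points_def by blast
      have exit: "\<exists>t\<ge>0. x + t *\<^sub>R d \<in> convex hull E"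
        if d: "d \<in> Y" "\<forall>i\<in>I. \<phi> i x = b i \<longrightarrow> \<phi> i d = 0" "d \<noteq> 0" for d
      proof -
        obtain t j where t: "t \<ge> 0" "x + t *\<^sub>R d \<in> ?C" and j: "j \<in> I" "\<phi> j d > 0"
          and eq: "\<phi> j (x + t *\<^sub>R d) = b j"
          using solutions_first_exit[where \<phi> = \<phi>, OF Y fin lin less.prems d(1) bounded[OF d(1,3)]] by blast
        have "{i \<in> I. \<phi> i (x + t *\<^sub>R d) \<noteq> b i} \<subset> {i \<in> I. \<phi> i x \<noteq> b i}"
        proof
          show "{i \<in> I. \<phi> i (x + t *\<^sub>R d) \<noteq> b i} \<subseteq> {i \<in> I. \<phi> i x \<noteq> b i}"
            using d(2) lin by (auto simp: linear_add linear_scale)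
          show "{i \<in> I. \<phi> i (x + t *\<^sub>R d) \<noteq> b i} \<noteq> {i \<in> I. \<phi> i x \<noteq> b i}"
            using j eq d(2) by force
        qed
        then have "card {i \<in> I. \<phi> i (x + t *\<^sub>R d) \<noteq> b i} < card {i \<in> I. \<phi> i x \<noteq> b i}"
          using fin by (intro psubset_card_mono) auto
        with less.hyps t show ?thesis by blast
      qed
      obtain t where t: "t \<ge> 0" "x + t *\<^sub>R d \<in> convex hull E" using exit[OF d] by blast
      have "\<exists>s\<ge>0. x + s *\<^sub>R (- d) \<in> convex hull E"
        using d lin Y by (intro exit) (auto simp: linear_neg subspace_neg)
      then obtain s where s: "s \<ge> 0" "x + s *\<^sub>R (- d) \<in> convex hull E" by blast
      show ?thesis
      proof (cases "t + s = 0")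
        case True
        then have "t = 0" using t(1) s(1) by linarith
        then show ?thesis using t(2) by simp
      next
        case False
        then have pos: "t + s > 0" using t(1) s(1) by linarith
        have "(s / (t + s)) *\<^sub>R (x + t *\<^sub>R d) + (t / (t + s)) *\<^sub>R (x + s *\<^sub>R (- d))
            = (s / (t + s) + t / (t + s)) *\<^sub>R x"
          by (simp add: algebra_simps)
        also have "s / (t + s) + t / (t + s) = 1" using False by (simp add: add.commute flip: add_divide_distrib)
        finally have eq: "(s / (t + s)) *\<^sub>R (x + t *\<^sub>R d) + (t / (t + s)) *\<^sub>R (x + s *\<^sub>R (- d)) = x"
          by simp
        have "(s / (t + s)) *\<^sub>R (x + t *\<^sub>R d) + (t / (t + s)) *\<^sub>R (x + s *\<^sub>R (- d)) \<in> convex hull E"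
          using t s pos by (intro convexD[OF convex_convex_hull]) (auto simp: add.commute simp flip: add_divide_distrib)
        then show ?thesis by (simp only: eq)
      qed
    qed
  qed
  moreover have "convex hull E \<subseteq> ?C"
    using convex by (intro hull_minimal) (auto simp: E_def extreme_points_def extreme_point_of_def)
  moreover have "finite E" unfolding E_def by (rule finite_extreme_points_solutions[OF Y fin]) (rule lin)
  ultimately show ?thesis unfolding polytope_def by blast
qed

text \<open>The coefficients that represent points of the intersection as convex combinations of the vertices
  of \<open>P\<close> form the solution set of finitely many inequalities in the space of finitely supported
  functions on the vertices. That set is a polytope, and the intersection is a linear image of it.
  This avoids describing \<open>P\<close> itself by inequalities.\<close>

lemma polytope_Int_subspace:
  fixes P W :: "'a::real_vector set"
  assumes P: "polytope P" and W: "subspace W"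
  shows "polytope (P \<inter> W)"
proof -
  obtain S where S: "finite S" "P = convex hull S" using P by (auto simp: polytope_def)
  define T where "T l = (\<Sum>v\<in>S. l v *\<^sub>R v)" for l :: "'a \<Rightarrow> real"
  define Y where "Y = {l. (\<forall>v. v \<notin> S \<longrightarrow> l v = 0) \<and> T l \<in> W}"
  have T: "linear T"
    by (rule linearI)
      (auto simp: T_def scaleR_add_left sum.distrib scaleR_sum_right)
  have Y: "subspace Y"
    unfolding subspace_def Y_def using W T
    by (auto simp: linear_0 linear_add linear_scale subspace_0 subspace_add subspace_scale)
  define I where "I = (\<lambda>v. (\<lambda>l :: 'a \<Rightarrow> real. - l v, 0 :: real)) ` S \<union> {(\<lambda>l. sum l S, 1), (\<lambda>l. - sum l S, -1)}"
  have "polytope (solutions Y I fst snd)"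
  proof (rule polytope_solutions[OF Y])
    show "finite I" using S(1) by (simp add: I_def)
    show "linear (fst i)" if "i \<in> I" for i
      using that by (auto simp: I_def intro!: linearI simp: sum.distrib sum_distrib_left)
    fix l assume l: "l \<in> Y" "l \<noteq> 0"
    show "\<exists>i\<in>I. fst i l > 0"
    proof (rule ccontr)
      assume "\<not> ?thesis"
      then have *: "\<forall>v\<in>S. l v \<ge> 0" "sum l S \<le> 0" by (auto simp: I_def not_less)
      then have "sum l S = 0" by (meson antisym sum_nonneg)
      then have "\<forall>v\<in>S. l v = 0" using * S(1) by (simp add: sum_nonneg_eq_0_iff)
      then have "l = 0" using l(1) by (auto simp: Y_def fun_eq_iff)
      with l(2) show False by simp
    qed
  qed
  moreover have "T ` solutions Y I fst snd = P \<inter> W"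
  proof (intro equalityI subsetI)
    fix y assume "y \<in> T ` solutions Y I fst snd"
    then obtain l where "T l = y" "T l \<in> W" "\<forall>v\<in>S. l v \<ge> 0" "sum l S = 1"
      by (auto simp: solutions_def I_def Y_def)
    then show "y \<in> P \<inter> W" by (auto simp: S(2) convex_hull_finite[OF S(1)] T_def)
  next
    fix y assume y: "y \<in> P \<inter> W"
    then obtain u where u: "\<forall>v\<in>S. 0 \<le> u v" "sum u S = 1" "T u = y"
      by (auto simp: S(2) convex_hull_finite[OF S(1)] T_def)
    define l where "l v = (if v \<in> S then u v else 0)" for v
    have "T l = y" "sum l S = 1" using u by (auto simp: T_def l_def cong: sum.cong)
    moreover have "l \<in> solutions Y I fst snd"
      using u y calculation by (auto simp: solutions_def I_def Y_def l_def)
    ultimately show "y \<in> T ` solutions Y I fst snd" by blast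
  qed
  ultimately show ?thesis
    unfolding polytope_def by (metis T convex_hull_linear_image finite_imageI)
qed

section \<open>Dual balls, faces and strongly exposed points\<close>

context normed_space
begin

lemma norm_0 [simp]: "N 0 = 0"
  using norm_eq_0_iff subspace_0[OF subspace_carrier] by blast

lemma norm_minus: "x \<in> V \<Longrightarrow> N (- x) = N x"
  using norm_scaleR[of x "-1"] by simp

lemma norm_diff_commute: "\<lbrakk>x \<in> V; y \<in> V\<rbrakk> \<Longrightarrow> N (x - y) = N (y - x)"
  using norm_minus[of "x - y"] subspace_diff[OF subspace_carrier] by auto

lemma norm_nonneg: "x \<in> V \<Longrightarrow> 0 \<le> N x"
  using norm_triangle[of x "- x"] norm_minus[of x] subspace_neg[OF subspace_carrier] by auto

lemma norm_pos: "\<lbrakk>x \<in> V; x \<noteq> 0\<rbrakk> \<Longrightarrow> 0 < N x"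
  using norm_nonneg[of x] norm_eq_0_iff[of x] by linarith

lemma norm_diff_triangle: "\<lbrakk>x \<in> V; y \<in> V; z \<in> V\<rbrakk> \<Longrightarrow> N (x - z) \<le> N (x - y) + N (y - z)"
  using norm_triangle[of "x - y" "y - z"] subspace_diff[OF subspace_carrier] by auto

text \<open>The topological notion is used only through this metric reformulation.\<close>

lemma interior_of_face_ball:
  assumes "p \<in> subtopology (norm_topology V N) H interior_of F"
  obtains \<rho> where "\<rho> > 0" "p \<in> V" "p \<in> H" "\<And>y. \<lbrakk>y \<in> V; y \<in> H; N (y - p) < \<rho>\<rbrakk> \<Longrightarrow> y \<in> F"
proof -
  interpret M: Metric_space V "norm_dist V N" by (rule Metric_space_norm_dist)
  obtain T where T: "openin M.mtopology T" "p \<in> T" "p \<in> H" "T \<inter> H \<subseteq> F"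
    using assms unfolding interior_of_def norm_topology_def openin_subtopology by blast
  then obtain \<rho> where \<rho>: "\<rho> > 0" "M.mball p \<rho> \<subseteq> T" "p \<in> V"
    unfolding M.openin_mtopology by blast
  show thesis
  proof
    fix y assume y: "y \<in> V" "y \<in> H" "N (y - p) < \<rho>"
    then have "y \<in> M.mball p \<rho>"
      using \<rho>(3) norm_diff_commute[of y p] by (simp add: M.in_mball norm_dist_def)
    then show "y \<in> F" using \<rho>(2) T(4) y(2) by blast
  qed (use \<rho> T in auto)
qed

lemma in_closure_of_iff:
  assumes "S \<subseteq> V"
  shows "x \<in> norm_topology V N closure_of S \<longleftrightarrow> x \<in> V \<and> (\<forall>\<rho>>0. \<exists>y\<in>S. N (y - x) < \<rho>)"
proof -
  interpret M: Metric_space V "norm_dist V N" by (rule Metric_space_norm_dist)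
  have "y \<in> M.mball x r \<longleftrightarrow> N (y - x) < r" if "x \<in> V" "y \<in> S" for y r
    using that assms norm_diff_commute[of x y] by (auto simp: M.in_mball norm_dist_def)
  then show ?thesis
    unfolding norm_topology_def M.metric_closure_of by blast
qed

lemma limitin_norm_topology_iff:
  assumes "\<And>n. y n \<in> V" "x \<in> V"
  shows "limitin (norm_topology V N) y x sequentially \<longleftrightarrow> (\<lambda>n. N (y n - x)) \<longlonglongrightarrow> 0"
proof -
  interpret M: Metric_space V "norm_dist V N" by (rule Metric_space_norm_dist)
  show ?thesis
    unfolding norm_topology_def M.limitin_metric_dist_null using assms
    by (simp add: norm_dist_def)
qed

lemma topological_dualD:
  assumes "f \<in> topological_dual V N"
  shows "\<lbrakk>x \<in> V; y \<in> V\<rbrakk> \<Longrightarrow> f (x + y) = f x + f y"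
    and "x \<in> V \<Longrightarrow> f (c *\<^sub>R x) = c * f x"
    and "x \<notin> V \<Longrightarrow> f x = 0"
    and "\<lbrakk>x \<in> V; y \<in> V\<rbrakk> \<Longrightarrow> f (x - y) = f x - f y"
    and "x \<in> V \<Longrightarrow> f (- x) = - f x"
    and "f 0 = 0"
proof -
  show add: "f (x + y) = f x + f y" if "x \<in> V" "y \<in> V" for x y
    using assms that by (simp add: topological_dual_def)
  show scale: "f (c *\<^sub>R x) = c * f x" if "x \<in> V" for c x
    using assms that by (simp add: topological_dual_def)
  show "x \<notin> V \<Longrightarrow> f x = 0" using assms by (simp add: topological_dual_def)
  show neg: "f (- x) = - f x" if "x \<in> V" for x
    using scale[of x "-1"] that by simp
  show "f (x - y) = f x - f y" if "x \<in> V" "y \<in> V"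
    using add[of x "- y"] neg[of y] that subspace_neg[OF subspace_carrier] by simp
  show "f 0 = 0" using scale[of 0 0] subspace_0[OF subspace_carrier] by simp
qed

lemma subspace_topological_dual: "subspace (topological_dual V N)"
  unfolding subspace_def
proof (intro conjI ballI allI)
  show "0 \<in> topological_dual V N"
    by (auto simp: topological_dual_def intro: exI[of _ 0])
  fix f g c assume f: "f \<in> topological_dual V N"
  obtain K where K: "\<forall>x\<in>V. \<bar>f x\<bar> \<le> K * N x" using f by (auto simp: topological_dual_def)
  have "\<bar>c * f x\<bar> \<le> (\<bar>c\<bar> * K) * N x" if "x \<in> V" for x
    using K that by (simp add: abs_mult mult.assoc mult_left_mono)
  then show "c *\<^sub>R f \<in> topological_dual V N"
    using f unfolding topological_dual_def by (auto simp: distrib_left)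
  assume g: "g \<in> topological_dual V N"
  obtain L where L: "\<forall>x\<in>V. \<bar>g x\<bar> \<le> L * N x" using g by (auto simp: topological_dual_def)
  have "\<bar>f x + g x\<bar> \<le> (K + L) * N x" if "x \<in> V" for x
  proof -
    have "\<bar>f x + g x\<bar> \<le> \<bar>f x\<bar> + \<bar>g x\<bar>" by (rule abs_triangle_ineq)
    also have "\<dots> \<le> K * N x + L * N x" using K L that by (intro add_mono) auto
    finally show ?thesis by (simp add: distrib_right)
  qed
  then show "f + g \<in> topological_dual V N"
    using f g unfolding topological_dual_def by (auto simp: distrib_left)
qed

lemma abs_le_dual_norm:
  assumes f: "f \<in> topological_dual V N" and x: "x \<in> V"
  shows "\<bar>f x\<bar> \<le> dual_norm V N f * N x"
proof (cases "x = 0")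
  case True
  then show ?thesis using topological_dualD(6)[OF f] by simp
next
  case False
  obtain K where K: "\<And>x. x \<in> V \<Longrightarrow> \<bar>f x\<bar> \<le> K * N x" using f unfolding topological_dual_def by blast
  have bdd: "bdd_above ((\<lambda>x. \<bar>f x\<bar>) ` unit_ball V N)"
  proof (rule bdd_aboveI2)
    fix x assume "x \<in> unit_ball V N"
    then have x: "x \<in> V" "N x \<le> 1" by (auto simp: unit_ball_def)
    have "\<bar>f x\<bar> \<le> K * N x" using K x by blast
    also have "\<dots> \<le> \<bar>K\<bar> * N x" using norm_nonneg[OF x(1)] by (intro mult_right_mono) auto
    also have "\<dots> \<le> \<bar>K\<bar> * 1" using x(2) by (intro mult_left_mono) auto
    finally show "\<bar>f x\<bar> \<le> \<bar>K\<bar>" by simp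
  qed
  have pos: "N x > 0" using x False by (rule norm_pos)
  have "(1 / N x) *\<^sub>R x \<in> unit_ball V N"
    using x pos norm_scaleR[OF x] subspace_scale[OF subspace_carrier x] by (simp add: unit_ball_def)
  then have "\<bar>f ((1 / N x) *\<^sub>R x)\<bar> \<le> dual_norm V N f"
    unfolding dual_norm_def by (rule cSUP_upper[OF _ bdd])
  then show ?thesis using topological_dualD(2)[OF f x] pos by (simp add: abs_mult field_simps)
qed

lemma dual_norm_le:
  assumes "f \<in> topological_dual V N" "\<And>x. x \<in> V \<Longrightarrow> \<bar>f x\<bar> \<le> N x"
  shows "dual_norm V N f \<le> 1"
  unfolding dual_norm_def
proof (rule cSUP_least)
  show "unit_ball V N \<noteq> {}"
    using subspace_0[OF subspace_carrier] by (force simp: unit_ball_def)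
qed (use assms in \<open>force simp: unit_ball_def\<close>)

lemma dual_ball_iff:
  "f \<in> dual_ball V N \<longleftrightarrow> f \<in> topological_dual V N \<and> (\<forall>x\<in>V. \<bar>f x\<bar> \<le> N x)"
proof (intro iffI conjI ballI)
  assume f: "f \<in> dual_ball V N"
  then show f': "f \<in> topological_dual V N" by (simp add: dual_ball_def unit_ball_def)
  fix x assume x: "x \<in> V"
  have "dual_norm V N f * N x \<le> 1 * N x"
    using f norm_nonneg[OF x] by (intro mult_right_mono) (auto simp: dual_ball_def unit_ball_def)
  then show "\<bar>f x\<bar> \<le> N x" using abs_le_dual_norm[OF f' x] by simp
qed (auto simp: dual_ball_def unit_ball_def dual_norm_le)

lemma dual_sphere_subset_ball: "dual_sphere V N \<subseteq> dual_ball V N"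
  by (auto simp: dual_sphere_def dual_ball_def unit_sphere_def unit_ball_def)

lemma norming_functionals_eq:
  assumes x: "x \<in> unit_sphere V N"
  shows "norming_functionals V N x = {f \<in> dual_ball V N. f x = 1}"
proof -
  have "dual_norm V N f = 1" if f: "f \<in> dual_ball V N" "f x = 1" for f
  proof (rule antisym)
    show "dual_norm V N f \<le> 1" using f(1) by (simp add: dual_ball_def unit_ball_def)
    show "1 \<le> dual_norm V N f"
      using abs_le_dual_norm[of f x] f x by (simp add: dual_ball_iff unit_sphere_def)
  qed
  then show ?thesis
    using dual_sphere_subset_ball
    by (auto simp: norming_functionals_def dual_sphere_def dual_ball_def unit_sphere_def unit_ball_def)
qed

lemma supporting_hyperplanesE:
  assumes "H \<in> supporting_hyperplanes V N"
  obtains f where "f \<in> topological_dual V N" "\<And>x. x \<in> V \<Longrightarrow> \<bar>f x\<bar> \<le> N x" "H = {x \<in> V. f x = 1}"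
proof -
  obtain f where f: "f \<in> dual_sphere V N" "H = {x \<in> V. f x = 1}"
    using assms by (auto simp: supporting_hyperplanes_def)
  then have "f \<in> dual_ball V N" using dual_sphere_subset_ball by blast
  then show thesis using that f(2) by (auto simp: dual_ball_iff)
qed

lemma true_faces_subset_algebraic: "true_faces V N \<subseteq> algebraic_true_faces V N"
proof
  fix F assume "F \<in> true_faces V N"
  then obtain H p where H: "H \<in> supporting_hyperplanes V N" "F = unit_ball V N \<inter> H"
    and p: "p \<in> subtopology (norm_topology V N) H interior_of F"
    by (auto simp: true_faces_def)
  obtain \<rho> where \<rho>: "\<rho> > 0" "p \<in> V" "p \<in> H" "\<And>y. \<lbrakk>y \<in> V; y \<in> H; N (y - p) < \<rho>\<rbrakk> \<Longrightarrow> y \<in> F"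
    using interior_of_face_ball[OF p] by blast
  obtain f where f: "f \<in> topological_dual V N" "H = {x \<in> V. f x = 1}"
    using supporting_hyperplanesE[OF H(1)] by blast
  have "p \<in> algebraic_interior_rel H F"
    unfolding algebraic_interior_rel_def
  proof (intro CollectI conjI ballI)
    show "p \<in> F" by (rule subsetD[OF interior_of_subset p])
    fix q assume q: "q \<in> H"
    then have d: "q - p \<in> V" "f (q - p) = 0"
      using f \<rho>(2,3) subspace_diff[OF subspace_carrier] topological_dualD(4)[OF f(1)] by auto
    define \<delta> where "\<delta> = \<rho> / (2 * (N (q - p) + 1))"
    have pos: "\<delta> > 0" using \<rho>(1) norm_nonneg[OF d(1)] by (simp add: \<delta>_def)
    have "p + t *\<^sub>R (q - p) \<in> F" if t: "\<bar>t\<bar> \<le> \<delta>" for t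
    proof (rule \<rho>(4))
      have td: "t *\<^sub>R (q - p) \<in> V" using d subspace_scale[OF subspace_carrier] by blast
      then show *: "p + t *\<^sub>R (q - p) \<in> V" using \<rho>(2) subspace_add[OF subspace_carrier] by blast
      have "f (p + t *\<^sub>R (q - p)) = 1"
        using topological_dualD(1)[OF f(1) \<rho>(2) td] topological_dualD(2)[OF f(1) d(1)] d(2) \<rho>(3) f(2)
        by simp
      then show "p + t *\<^sub>R (q - p) \<in> H" using * f(2) by simp
      have "N (p + t *\<^sub>R (q - p) - p) = \<bar>t\<bar> * N (q - p)" using norm_scaleR[OF d(1)] by simp
      also have "\<dots> \<le> \<delta> * (N (q - p) + 1)"
        using t pos norm_nonneg[OF d(1)] by (intro mult_mono) auto
      also have "\<dots> = \<rho> / 2" using norm_nonneg[OF d(1)] by (simp add: \<delta>_def field_simps)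
      finally show "N (p + t *\<^sub>R (q - p) - p) < \<rho>" using \<rho>(1) by simp
    qed
    then show "\<exists>\<delta>>0. \<forall>t. \<bar>t\<bar> \<le> \<delta> \<longrightarrow> p + t *\<^sub>R (q - p) \<in> F" using pos by blast
  qed
  then show "F \<in> algebraic_true_faces V N" using H by (auto simp: algebraic_true_faces_def)
qed

text \<open>A linear estimate of the distance to \<open>v\<close> by the defect \<open>f v - f y\<close> gives both the exposedness and
  the convergence of maximizing sequences.\<close>

lemma strongly_exposedI:
  assumes v: "v \<in> unit_ball V N" and f: "f \<in> topological_dual V N"
    and bound: "\<And>y. y \<in> unit_ball V N \<Longrightarrow> N (y - v) \<le> C * (f v - f y)" and C: "C > 0"
  shows "v \<in> strongly_exposed_points V N (unit_ball V N)"
  unfolding strongly_exposed_points_def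
proof (intro CollectI conjI bexI[OF _ f] ballI impI allI v)
  have vV: "v \<in> V" using v by (simp add: unit_ball_def)
  fix y assume y: "y \<in> unit_ball V N" "y \<noteq> v"
  then have "N (y - v) > 0"
    using vV subspace_diff[OF subspace_carrier] by (intro norm_pos) (auto simp: unit_ball_def)
  then have "C * (f v - f y) > 0" using bound[OF y(1)] by linarith
  then show "f y < f v" using C by (simp add: zero_less_mult_iff)
next
  have vV: "v \<in> V" using v by (simp add: unit_ball_def)
  fix y assume y: "(\<forall>n. y n \<in> unit_ball V N) \<and> (\<lambda>n. f (y n)) \<longlonglongrightarrow> f v"
  then have yV: "y n \<in> V" for n by (simp add: unit_ball_def)
  have "(\<lambda>n. C * (f v - f (y n))) \<longlonglongrightarrow> C * (f v - f v)"
    using y by (intro tendsto_intros) auto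
  then have lim: "(\<lambda>n. C * (f v - f (y n))) \<longlonglongrightarrow> 0" by simp
  have "(\<lambda>n. N (y n - v)) \<longlonglongrightarrow> 0"
    using bound y norm_nonneg subspace_diff[OF subspace_carrier] yV vV
    by (intro tendsto_sandwich[OF _ _ tendsto_const lim]) auto
  then show "limitin (norm_topology V N) y v sequentially"
    by (simp add: limitin_norm_topology_iff yV vV)
qed

lemma unit_sphere_nonempty:
  assumes "a \<in> V" "a \<noteq> 0"
  shows "unit_sphere V N \<noteq> {}"
proof -
  have "(1 / N a) *\<^sub>R a \<in> unit_sphere V N"
    using assms norm_pos[of a] norm_scaleR[of a "1 / N a"] subspace_scale[OF subspace_carrier]
    by (simp add: unit_sphere_def)
  then show ?thesis by blast
qed

text \<open>Near an interior point \<open>p\<close> of a true face there is a strongly exposed point \<open>v\<close>. Scaling it back to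
  the hyperplane gives a point of the face, which forces \<open>v\<close> itself onto the hyperplane and into
  the interior. As the hyperplane contains a line through \<open>v\<close>, the point \<open>v\<close> is the midpoint of
  a segment in the ball and cannot be exposed. The vectors \<open>a\<close> and \<open>b\<close> make the dimension at
  least two.\<close>

lemma true_faces_empty_if_strongly_exposed_dense:
  assumes dense: "unit_sphere V N \<subseteq>
      norm_topology V N closure_of strongly_exposed_points V N (unit_ball V N)"
    and ab: "a \<in> V" "b \<in> V" "\<And>s t :: real. s *\<^sub>R a + t *\<^sub>R b = 0 \<Longrightarrow> s = 0 \<and> t = 0"
  shows "true_faces V N = {}"
proof (rule ccontr)
  note sub = subspace_carrier
  assume "true_faces V N \<noteq> {}"
  then obtain F H p where H: "H \<in> supporting_hyperplanes V N" "F = unit_ball V N \<inter> H"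
    and p: "p \<in> subtopology (norm_topology V N) H interior_of F"
    unfolding true_faces_def by blast
  obtain \<rho> where \<rho>: "\<rho> > 0" "p \<in> V" "p \<in> H" "\<And>y. \<lbrakk>y \<in> V; y \<in> H; N (y - p) < \<rho>\<rbrakk> \<Longrightarrow> y \<in> F"
    using interior_of_face_ball[OF p] by blast
  obtain f where f: "f \<in> topological_dual V N" "\<And>x. x \<in> V \<Longrightarrow> \<bar>f x\<bar> \<le> N x" "H = {x \<in> V. f x = 1}"
    using supporting_hyperplanesE[OF H(1)] by blast
  note flin = topological_dualD[OF f(1)]
  have "p \<in> F" by (rule subsetD[OF interior_of_subset p])
  then have p1: "N p = 1" "f p = 1" using H(2) f(2)[of p] \<rho>(2,3) f(3) by (auto simp: unit_ball_def)
  then have "p \<in> norm_topology V N closure_of strongly_exposed_points V N (unit_ball V N)"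
    using dense \<rho>(2) by (auto simp: unit_sphere_def)
  moreover have "strongly_exposed_points V N (unit_ball V N) \<subseteq> V"
    by (auto simp: strongly_exposed_points_def unit_ball_def)
  \<comment> \<open>\<open>\<sigma> \<le> 1/2\<close> keeps \<open>f v\<close> away from \<open>0\<close>; rescaling costs at most \<open>2\<sigma>\<close>, and \<open>3\<sigma> < \<rho>\<close>.\<close>
  moreover define \<sigma> where "\<sigma> = min (1/2) (\<rho> / 4)"
  moreover have \<sigma>: "\<sigma> > 0" "\<sigma> \<le> 1/2" "\<sigma> \<le> \<rho> / 4" using \<rho>(1) by (auto simp: \<sigma>_def)
  ultimately obtain v where v: "v \<in> strongly_exposed_points V N (unit_ball V N)" "v \<in> V"
    "N (v - p) < \<sigma>"
    by (meson in_closure_of_iff subset_iff)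
  have v1: "N v \<le> 1" using v(1) by (simp add: strongly_exposed_points_def unit_ball_def)
  then have fv1: "f v \<le> 1" using f(2)[OF v(2)] by auto
  have vp: "v - p \<in> V" using v(2) \<rho>(2) subspace_diff[OF sub] by blast
  have fv: "1 - f v \<le> N (v - p)"
    using f(2)[OF vp] flin(4)[OF v(2) \<rho>(2)] p1(2) by auto
  then have fvpos: "f v \<ge> 1/2" using v(3) \<sigma> by linarith
  define u where "u = (1 / f v) *\<^sub>R v"
  have uV: "u \<in> V" using v(2) subspace_scale[OF sub] by (simp add: u_def)
  have "u - v = (1 / f v - 1) *\<^sub>R v" by (simp add: u_def algebra_simps)
  then have "N (u - v) = \<bar>1 / f v - 1\<bar> * N v" using norm_scaleR[OF v(2)] by simp
  also have "\<dots> \<le> \<bar>1 / f v - 1\<bar> * 1" using v1 by (intro mult_left_mono) auto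
  also have "\<dots> = (1 - f v) / f v" using fvpos fv1 by (simp add: field_simps)
  also have "\<dots> \<le> 2 * (1 - f v)"
  proof -
    have "(1 - f v) * 1 \<le> (1 - f v) * (2 * f v)" using fvpos fv1 by (intro mult_left_mono) auto
    then show ?thesis using fvpos by (simp add: divide_le_eq mult_ac)
  qed
  finally have uv: "N (u - v) \<le> 2 * (1 - f v)" .
  have "2 * (1 - f v) \<le> 2 * N (v - p)" using fv by simp
  then have "N (u - p) \<le> 3 * N (v - p)"
    using norm_diff_triangle[OF uV v(2) \<rho>(2)] uv by linarith
  also have "\<dots> < 3 * \<sigma>" using v(3) by simp
  finally have "N (u - p) < \<rho>" using \<sigma> \<rho>(1) by linarith
  moreover have "f u = 1" using flin(2)[OF v(2)] fvpos by (simp add: u_def)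
  ultimately have "u \<in> F" using \<rho>(4) uV f(3) by simp
  then have "N u \<le> 1" using H(2) by (simp add: unit_ball_def)
  then have "N v \<le> f v" using norm_scaleR[OF v(2)] fvpos by (simp add: u_def field_simps)
  \<comment> \<open>Otherwise \<open>v\<close> would lie strictly between \<open>0\<close> and its normalization \<open>w\<close>, which is in the ball.\<close>
  moreover have "N v = 1"
  proof (rule antisym[OF v1], rule ccontr)
    assume "\<not> 1 \<le> N v"
    obtain g where g: "g \<in> topological_dual V N"
      "\<And>y. \<lbrakk>y \<in> unit_ball V N; y \<noteq> v\<rbrakk> \<Longrightarrow> g y < g v"
      using v(1) by (auto simp: strongly_exposed_points_def)
    have pos: "N v > 0" using fvpos f(2)[OF v(2)] by linarith
    define w where "w = (1 / N v) *\<^sub>R v"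
    have w: "w \<in> unit_ball V N" "- w \<in> unit_ball V N"
      using norm_scaleR[OF v(2)] pos v(2) subspace_scale[OF sub] subspace_neg[OF sub] norm_minus[of w]
      by (auto simp: w_def unit_ball_def)
    have gw: "g w = g v / N v" "g (- w) = - (g v / N v)"
      using topological_dualD[OF g(1)] v(2) w by (auto simp: w_def unit_ball_def)
    have "v \<noteq> 0" using pos by auto
    have neq: "w \<noteq> v"
    proof
      assume "w = v"
      then have "N w = N v" by simp
      then show False using norm_scaleR[OF v(2), of "1 / N v"] pos \<open>\<not> 1 \<le> N v\<close> by (simp add: w_def)
    qed
    then have 1: "g v / N v < g v" using g(2)[OF w(1)] gw by simp
    have 0: "0 \<in> unit_ball V N" using subspace_0[OF sub] by (simp add: unit_ball_def)
    have "0 < g v" using g(2)[OF 0] \<open>v \<noteq> 0\<close> topological_dualD(6)[OF g(1)] by simp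
    then have "g v \<le> g v / N v" using v1 pos by (simp add: le_divide_eq mult_left_le)
    with 1 show False by simp
  qed
  ultimately have fv_eq: "f v = 1" using fv1 by simp
  then have "u = v" by (simp add: u_def)
  \<comment> \<open>A direction in the hyperplane, from the two independent vectors.\<close>
  obtain d where d: "d \<in> V" "d \<noteq> 0" "f d = 0"
  proof (cases "f a = 0")
    case True
    have "a \<noteq> 0" using ab(3)[of 1 0] by auto
    then show thesis using that True ab(1) by blast
  next
    case False
    let ?d = "f b *\<^sub>R a - f a *\<^sub>R b"
    have "?d \<noteq> 0" using ab(3)[of "f b" "- f a"] False by auto
    moreover have in_V: "f b *\<^sub>R a \<in> V" "f a *\<^sub>R b \<in> V" using ab subspace_scale[OF sub] by auto
    moreover have "f ?d = 0" using flin(4)[OF in_V] flin(2)[OF ab(1)] flin(2)[OF ab(2)] by simp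
    ultimately show thesis using that subspace_diff[OF sub] by blast
  qed
  define e where "e = (\<sigma> / N d) *\<^sub>R d"
  have dpos: "N d > 0" using d norm_pos by blast
  have e: "e \<in> V" "e \<noteq> 0" "f e = 0" "N e = \<sigma>"
    using d dpos \<sigma> flin(2)[OF d(1)] norm_scaleR[OF d(1)] subspace_scale[OF sub] by (auto simp: e_def)
  have near: "v + x \<in> unit_ball V N" if x: "x \<in> V" "f x = 0" "N x = \<sigma>" for x
  proof -
    have "N (v + x - p) \<le> N (v + x - v) + N (v - p)"
      using x v(2) \<rho>(2) subspace_add[OF sub] by (intro norm_diff_triangle) auto
    then have "N (v + x - p) < \<rho>" using x(3) v(3) \<sigma> \<rho>(1) by simp
    then have "v + x \<in> F"
      using x v(2) subspace_add[OF sub] flin(1)[OF v(2) x(1)] fv_eq f(3) by (intro \<rho>(4)) auto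
    then show ?thesis using H(2) by simp
  qed
  have plus: "v + e \<in> unit_ball V N" by (rule near) (use e in auto)
  have minus: "v + - e \<in> unit_ball V N"
    by (rule near) (use e norm_minus flin(5) subspace_neg[OF sub] in auto)
  obtain g where g: "g \<in> topological_dual V N" "\<And>y. \<lbrakk>y \<in> unit_ball V N; y \<noteq> v\<rbrakk> \<Longrightarrow> g y < g v"
    using v(1) by (auto simp: strongly_exposed_points_def)
  have "g (v + e) < g v" "g (v + - e) < g v" using g(2) plus minus e(2) by auto
  then show False
    using topological_dualD[OF g(1)] v(2) e(1) subspace_neg[OF sub] by auto
qed

end

section \<open>Finitely supported sequences\<close>

definition unit_seq :: "nat \<Rightarrow> nat \<Rightarrow> real"
  where "unit_seq k = (\<lambda>i. if i = k then 1 else 0)"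

text \<open>The chain of finite-dimensional subspaces on which norms and functionals are computed.\<close>

definition c00_upto :: "nat \<Rightarrow> (nat \<Rightarrow> real) set"
  where "c00_upto n = {x. \<forall>k\<ge>n. x k = 0}"

definition c00 :: "(nat \<Rightarrow> real) set"
  where "c00 = (\<Union>n. c00_upto n)"

lemma unit_seq_apply [simp]: "unit_seq k i = (if i = k then 1 else 0)"
  by (simp add: unit_seq_def)

lemma subspace_c00_upto: "subspace (c00_upto n)"
  by (auto simp: subspace_def c00_upto_def)

lemma c00_upto_mono: "m \<le> n \<Longrightarrow> c00_upto m \<subseteq> c00_upto n"
  by (auto simp: c00_upto_def)

lemma unit_seq_in_c00_upto [simp]: "unit_seq k \<in> c00_upto n \<longleftrightarrow> k < n"
  by (auto simp: c00_upto_def not_less)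

lemma c00_upto_subset: "c00_upto n \<subseteq> c00"
  by (auto simp: c00_def)

lemma unit_seq_in_c00 [simp]: "unit_seq k \<in> c00"
  using c00_upto_subset[of "Suc k"] unit_seq_in_c00_upto[of k "Suc k"] by blast

lemma c00_uptoE:
  assumes "x \<in> c00" obtains n where "x \<in> c00_upto n"
  using assms by (auto simp: c00_def)

lemma c00_uptoE2:
  assumes "x \<in> c00" "y \<in> c00" obtains n where "x \<in> c00_upto n" "y \<in> c00_upto n"
proof -
  obtain m n where "x \<in> c00_upto m" "y \<in> c00_upto n" using assms by (auto simp: c00_def)
  then have "x \<in> c00_upto (max m n)" "y \<in> c00_upto (max m n)"
    using c00_upto_mono[of m "max m n"] c00_upto_mono[of n "max m n"] by auto
  then show thesis by (rule that)
qed

lemma subspace_c00: "subspace c00"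
  unfolding subspace_def
proof (intro conjI ballI allI)
  show "0 \<in> c00" using subspace_0[OF subspace_c00_upto[of 0]] c00_upto_subset by blast
  show "x + y \<in> c00" if "x \<in> c00" "y \<in> c00" for x y
    using that by (metis c00_uptoE2 subspace_add[OF subspace_c00_upto] c00_upto_subset subsetD)
  show "c *\<^sub>R x \<in> c00" if "x \<in> c00" for x and c :: real
    using that by (metis c00_uptoE subspace_scale[OF subspace_c00_upto] c00_upto_subset subsetD)
qed

lemma unit_seq_expansion:
  assumes "x \<in> c00_upto n"
  shows "x = (\<Sum>k<n. x k *\<^sub>R unit_seq k)"
proof
  fix i
  have "(\<Sum>k<n. x k *\<^sub>R unit_seq k) i = (\<Sum>k<n. if i = k then x k else 0)"
    unfolding sum_fun_apply by (rule sum.cong) auto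
  also have "\<dots> = x i" using assms by (auto simp: c00_upto_def)
  finally show "x i = (\<Sum>k<n. x k *\<^sub>R unit_seq k) i" by simp
qed

text \<open>Reduces \<open>K\<close>-polyhedrality to the members of a chain that exhausts the space.\<close>

lemma finite_span_subset_chain:
  fixes X :: "nat \<Rightarrow> 'a::real_vector set"
  assumes sub: "\<And>n. subspace (X n)" and mono: "\<And>m n. m \<le> n \<Longrightarrow> X m \<subseteq> X n"
    and B: "finite B" "B \<subseteq> (\<Union>n. X n)"
  shows "\<exists>n. span B \<subseteq> X n"
proof -
  have "\<exists>n. B \<subseteq> X n"
    using B
  proof (induction rule: finite_induct)
    case (insert b B)
    then obtain m n where "B \<subseteq> X m" "b \<in> X n" by auto
    then have "insert b B \<subseteq> X (max m n)"
      using mono[of m "max m n"] mono[of n "max m n"] by auto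
    then show ?case ..
  qed simp
  then show ?thesis using span_minimal[OF _ sub] by blast
qed

lemma (in normed_space) functional_sum:
  assumes f: "f \<in> topological_dual V N" and e: "\<And>k. k \<in> A \<Longrightarrow> e k \<in> V"
  shows "(\<Sum>k\<in>A. c k *\<^sub>R e k) \<in> V \<and> f (\<Sum>k\<in>A. c k *\<^sub>R e k) = (\<Sum>k\<in>A. c k * f (e k))"
  using e
proof (induction A rule: infinite_finite_induct)
  case (insert k A)
  then show ?case
    using topological_dualD[OF f] subspace_add[OF subspace_carrier] subspace_scale[OF subspace_carrier]
    by simp
qed (use topological_dualD(6)[OF f] subspace_0[OF subspace_carrier] in auto)

section \<open>The sum norm\<close>

definition l1_norm :: "(nat \<Rightarrow> real) \<Rightarrow> real"
  where "l1_norm x = (\<Sum>k | x k \<noteq> 0. \<bar>x k\<bar>)"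

text \<open>Sums over the support may be taken over any initial segment that contains it; only so can two
  vectors be treated with a common index set.\<close>

lemma support_sum_eq:
  fixes h :: "nat \<Rightarrow> real"
  assumes "x \<in> c00_upto n" "\<And>k. x k = 0 \<Longrightarrow> h k = 0"
  shows "(\<Sum>k | x k \<noteq> 0. h k) = (\<Sum>k<n. h k)"
  using assms by (intro sum.mono_neutral_left) (auto simp: c00_upto_def not_le[symmetric])

lemma l1_norm_eq: "x \<in> c00_upto n \<Longrightarrow> l1_norm x = (\<Sum>k<n. \<bar>x k\<bar>)"
  unfolding l1_norm_def by (rule support_sum_eq) auto

interpretation l1: normed_space c00 l1_norm
proof
  show "subspace c00" by (rule subspace_c00)
next
  fix x assume "x \<in> c00"
  then obtain n where n: "x \<in> c00_upto n" by (rule c00_uptoE)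
  then show "l1_norm x = 0 \<longleftrightarrow> x = 0"
    by (auto simp: l1_norm_eq sum_nonneg_eq_0_iff fun_eq_iff c00_upto_def not_less[symmetric])
  show "l1_norm (c *\<^sub>R x) = \<bar>c\<bar> * l1_norm x" for c
    using l1_norm_eq[OF n] l1_norm_eq[OF subspace_scale[OF subspace_c00_upto n]]
    by (simp add: abs_mult sum_distrib_left)
next
  fix x y assume "x \<in> c00" "y \<in> c00"
  then obtain n where n: "x \<in> c00_upto n" "y \<in> c00_upto n" by (rule c00_uptoE2)
  then show "l1_norm (x + y) \<le> l1_norm x + l1_norm y"
    using subspace_add[OF subspace_c00_upto n]
    by (simp add: l1_norm_eq sum.distrib[symmetric] sum_mono abs_triangle_ineq)
qed

lemma l1_functional_expansion:
  assumes "f \<in> topological_dual c00 l1_norm" "x \<in> c00_upto n"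
  shows "f x = (\<Sum>k<n. x k * f (unit_seq k))"
  using l1.functional_sum[OF assms(1), of "{..<n}" unit_seq x] unit_seq_expansion[OF assms(2)] by simp

text \<open>The dual is the space of bounded sequences with the supremum norm.\<close>

lemma l1_dual_ball_iff:
  "f \<in> dual_ball c00 l1_norm \<longleftrightarrow>
    f \<in> topological_dual c00 l1_norm \<and> (\<forall>k. \<bar>f (unit_seq k)\<bar> \<le> 1)"
proof -
  have "l1_norm (unit_seq k) = 1" for k
    using l1_norm_eq[of "unit_seq k" "Suc k"] by simp
  then have "\<bar>f (unit_seq k)\<bar> \<le> 1" if "f \<in> dual_ball c00 l1_norm" for k
    using that unit_seq_in_c00 unfolding l1.dual_ball_iff by metis
  moreover have "\<bar>f x\<bar> \<le> l1_norm x"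
    if f: "f \<in> topological_dual c00 l1_norm" "\<forall>k. \<bar>f (unit_seq k)\<bar> \<le> 1" and "x \<in> c00" for x
  proof -
    obtain n where n: "x \<in> c00_upto n" using \<open>x \<in> c00\<close> by (rule c00_uptoE)
    have "\<bar>f x\<bar> \<le> (\<Sum>k<n. \<bar>x k * f (unit_seq k)\<bar>)"
      unfolding l1_functional_expansion[OF f(1) n] by (rule sum_abs)
    also have "\<dots> \<le> (\<Sum>k<n. \<bar>x k\<bar>)"
      using f(2) by (intro sum_mono) (simp add: abs_mult mult_left_le)
    finally show ?thesis by (simp add: l1_norm_eq[OF n])
  qed
  ultimately show ?thesis unfolding l1.dual_ball_iff by blast
qed

text \<open>The functional with values \<open>\<sigma> k\<close> on the unit vectors, extended by \<open>0\<close> outside \<open>c00\<close>. It is used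
  mainly for sequences of signs, but also for coordinate functionals.\<close>

definition sign_functional :: "(nat \<Rightarrow> real) \<Rightarrow> (nat \<Rightarrow> real) \<Rightarrow> real"
  where "sign_functional \<sigma> x = (if x \<in> c00 then \<Sum>k | x k \<noteq> 0. x k * \<sigma> k else 0)"

lemma sign_functional_eq: "x \<in> c00_upto n \<Longrightarrow> sign_functional \<sigma> x = (\<Sum>k<n. x k * \<sigma> k)"
  using c00_upto_subset[of n] unfolding sign_functional_def by (auto intro: support_sum_eq)

lemma sign_functional_unit_seq [simp]: "sign_functional \<sigma> (unit_seq k) = \<sigma> k"
proof -
  have "sign_functional \<sigma> (unit_seq k) = (\<Sum>i<Suc k. unit_seq k i * \<sigma> i)"
    by (rule sign_functional_eq) simp
  also have "\<dots> = \<sigma> k" by simp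
  finally show ?thesis .
qed

lemma sign_functional_in_dual_ball:
  assumes "\<And>k. \<bar>\<sigma> k\<bar> \<le> 1"
  shows "sign_functional \<sigma> \<in> dual_ball c00 l1_norm"
proof -
  have "\<bar>sign_functional \<sigma> x\<bar> \<le> 1 * l1_norm x" if x: "x \<in> c00" for x
  proof -
    obtain n where n: "x \<in> c00_upto n" using x by (rule c00_uptoE)
    have "\<bar>sign_functional \<sigma> x\<bar> \<le> (\<Sum>k<n. \<bar>x k * \<sigma> k\<bar>)"
      unfolding sign_functional_eq[OF n] by (rule sum_abs)
    also have "\<dots> \<le> (\<Sum>k<n. \<bar>x k\<bar>)"
      using assms by (intro sum_mono) (simp add: abs_mult mult_left_le)
    finally show ?thesis by (simp add: l1_norm_eq[OF n])
  qed
  moreover have "sign_functional \<sigma> (x + y) = sign_functional \<sigma> x + sign_functional \<sigma> y"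
    if xy: "x \<in> c00" "y \<in> c00" for x y
  proof -
    obtain n where n: "x \<in> c00_upto n" "y \<in> c00_upto n" using xy by (rule c00_uptoE2)
    show ?thesis
      using n subspace_add[OF subspace_c00_upto n]
      by (simp add: sign_functional_eq distrib_right sum.distrib)
  qed
  moreover have "sign_functional \<sigma> (c *\<^sub>R x) = c * sign_functional \<sigma> x" if x: "x \<in> c00" for c x
  proof -
    obtain n where n: "x \<in> c00_upto n" using x by (rule c00_uptoE)
    show ?thesis
      using sign_functional_eq[OF n] sign_functional_eq[OF subspace_scale[OF subspace_c00_upto n]]
      by (simp add: sum_distrib_left mult.assoc)
  qed
  moreover have "sign_functional \<sigma> x = 0" if "x \<notin> c00" for x
    using that by (simp add: sign_functional_def)
  ultimately have "sign_functional \<sigma> \<in> topological_dual c00 l1_norm"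
    unfolding topological_dual_def by blast
  then show ?thesis using assms by (simp add: l1_dual_ball_iff)
qed

text \<open>The numbers \<open>1\<close> and \<open>-1\<close> are extreme in \<open>[-1, 1]\<close>, and a functional is determined by its values on
  the unit vectors. These functionals also show that the supremum in the definition of
  \<open>V\<close>-polyhedrality ranges over a nonempty set.\<close>

lemma sign_functional_extreme:
  assumes \<sigma>: "\<And>k. \<sigma> k = 1 \<or> \<sigma> k = -1"
  shows "sign_functional \<sigma> \<in> extreme_points (dual_ball c00 l1_norm)"
  unfolding extreme_points_def
proof (intro CollectI extreme_point_ofI)
  show "sign_functional \<sigma> \<in> dual_ball c00 l1_norm"
    using \<sigma> by (intro sign_functional_in_dual_ball) (metis abs_minus abs_one order_refl)
  fix f g and u :: real
  assume f: "f \<in> dual_ball c00 l1_norm" and g: "g \<in> dual_ball c00 l1_norm" and u: "0 < u" "u < 1"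
    and eq: "sign_functional \<sigma> = (1 - u) *\<^sub>R f + u *\<^sub>R g"
  have unit: "f (unit_seq k) = g (unit_seq k)" for k
  proof -
    let ?a = "f (unit_seq k)" and ?b = "g (unit_seq k)"
    have ab: "\<bar>?a\<bar> \<le> 1" "\<bar>?b\<bar> \<le> 1" using f g by (auto simp: l1_dual_ball_iff)
    have "\<sigma> k = (1 - u) * ?a + u * ?b" using fun_cong[OF eq, of "unit_seq k"] by simp
    then have 1: "(1 - u) * (1 - \<sigma> k * ?a) + u * (1 - \<sigma> k * ?b) = 0"
      using \<sigma>[of k] by (auto simp: algebra_simps)
    have nonneg: "0 \<le> 1 - \<sigma> k * ?a" "0 \<le> 1 - \<sigma> k * ?b" using \<sigma>[of k] ab by auto
    have "(1 - u) * (1 - \<sigma> k * ?a) = 0" "u * (1 - \<sigma> k * ?b) = 0"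
      using 1 nonneg u by (simp_all add: add_nonneg_eq_0_iff)
    then show ?thesis using u \<sigma>[of k] by auto
  qed
  show "f = g"
  proof
    fix x
    show "f x = g x"
    proof (cases "x \<in> c00")
      case True
      then obtain n where n: "x \<in> c00_upto n" by (rule c00_uptoE)
      then show ?thesis
        using f g unit l1_functional_expansion[of f x n] l1_functional_expansion[of g x n]
        by (simp add: l1_dual_ball_iff)
    next
      case False
      then show ?thesis
        using f g l1.topological_dualD(3)[of f x] l1.topological_dualD(3)[of g x]
        by (simp add: l1_dual_ball_iff)
    qed
  qed
qed

text \<open>If \<open>\<bar>f e\<^sub>k\<bar> < 1\<close>, then \<open>f\<close> can be moved both ways along the coordinate functional \<open>k\<close>.\<close>

lemma extreme_dual_l1_signs:
  assumes "f \<in> extreme_points (dual_ball c00 l1_norm)"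
  shows "f (unit_seq k) = 1 \<or> f (unit_seq k) = -1"
proof -
  have ext: "f extreme_point_of dual_ball c00 l1_norm" using assms by (simp add: extreme_points_def)
  then have f: "f \<in> topological_dual c00 l1_norm" "\<And>i. \<bar>f (unit_seq i)\<bar> \<le> 1"
    by (auto simp: extreme_point_of_def l1_dual_ball_iff)
  define h where "h = sign_functional (unit_seq k)"
  define c where "c = 1 - \<bar>f (unit_seq k)\<bar>"
  have h: "h \<in> topological_dual c00 l1_norm"
    using sign_functional_in_dual_ball[of "unit_seq k"] by (simp add: h_def l1_dual_ball_iff)
  note sub = l1.subspace_topological_dual
  have ends: "\<bar>f (unit_seq k) + c\<bar> \<le> 1" "\<bar>f (unit_seq k) - c\<bar> \<le> 1"
    using f(2)[of k] by (auto simp: c_def abs_if)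
  have "f + c *\<^sub>R h \<in> dual_ball c00 l1_norm" "f - c *\<^sub>R h \<in> dual_ball c00 l1_norm"
    using f h ends subspace_add[OF sub] subspace_diff[OF sub] subspace_scale[OF sub]
    by (auto simp: l1_dual_ball_iff h_def)
  then have "c *\<^sub>R h = 0" by (rule extreme_point_of_perturb[OF ext])
  then have "(c *\<^sub>R h) (unit_seq k) = 0" by (metis zero_fun_apply)
  then have "c = 0" by (simp add: h_def)
  then show ?thesis by (auto simp: c_def)
qed

text \<open>On \<open>x\<close> with support below \<open>n\<close> an extreme functional takes one of at most \<open>2\<^sup>n\<close> values, and those
  that do not norm \<open>x\<close> take values below \<open>1\<close>.\<close>

lemma V_polyhedral_l1: "V_polyhedral c00 l1_norm"
  unfolding V_polyhedral_def
proof
  fix x assume x: "x \<in> unit_sphere c00 l1_norm"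
  let ?E = "extreme_points (dual_ball c00 l1_norm) - norming_functionals c00 l1_norm x"
  obtain n where n: "x \<in> c00_upto n" using x by (auto simp: unit_sphere_def elim: c00_uptoE)
  have ball: "f \<in> dual_ball c00 l1_norm" if "f \<in> ?E" for f
    using that by (auto simp: extreme_points_def extreme_point_of_def)
  have "(\<lambda>f. f x) ` ?E \<subseteq> (\<lambda>S. \<Sum>k<n. if k \<in> S then x k else - x k) ` Pow {..<n}"
  proof
    fix r assume "r \<in> (\<lambda>f. f x) ` ?E"
    then obtain f where f: "f \<in> ?E" "r = f x" by blast
    have "f x = (\<Sum>k<n. x k * f (unit_seq k))"
      using ball[OF f(1)] n by (intro l1_functional_expansion) (auto simp: l1_dual_ball_iff)
    also have "\<dots> = (\<Sum>k<n. if k \<in> {k \<in> {..<n}. f (unit_seq k) = 1} then x k else - x k)"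
      using extreme_dual_l1_signs[of f] f(1) by (intro sum.cong) force+
    finally show "r \<in> (\<lambda>S. \<Sum>k<n. if k \<in> S then x k else - x k) ` Pow {..<n}"
      using f(2) by (intro image_eqI[where x = "{k \<in> {..<n}. f (unit_seq k) = 1}"]) auto
  qed
  then have fin: "finite ((\<lambda>f. f x) ` ?E)" by (rule finite_subset) simp
  have nonempty: "?E \<noteq> {}"
  proof -
    \<comment> \<open>Of two opposite extreme functionals at most one norms \<open>x\<close>.\<close>
    define s where "s c = sign_functional (\<lambda>_. c)" for c
    have ext: "s 1 \<in> extreme_points (dual_ball c00 l1_norm)" "s (-1) \<in> extreme_points (dual_ball c00 l1_norm)"
      unfolding s_def by (rule sign_functional_extreme; simp)+
    have "s (-1) x = - s 1 x" by (simp add: s_def sign_functional_eq[OF n] sum_negf)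
    then have "s 1 \<notin> norming_functionals c00 l1_norm x \<or> s (-1) \<notin> norming_functionals c00 l1_norm x"
      by (auto simp: norming_functionals_def)
    then show ?thesis using ext by blast
  qed
  have less: "f x < 1" if f: "f \<in> ?E" for f
  proof -
    have "\<bar>f x\<bar> \<le> 1" using ball[OF f] x by (auto simp: l1.dual_ball_iff unit_sphere_def)
    moreover have "f x \<noteq> 1" using ball[OF f] f by (auto simp: l1.norming_functionals_eq[OF x])
    ultimately show ?thesis by auto
  qed
  have "(SUP f\<in>?E. f x) \<in> (\<lambda>f. f x) ` ?E"
    using fin nonempty by (subst cSup_eq_Max) (auto intro: Max_in)
  then show "(SUP f\<in>?E. f x) < 1" using less by auto
qed

lemma no_algebraic_true_faces_l1: "algebraic_true_faces c00 l1_norm = {}"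
proof (rule ccontr)
  assume "algebraic_true_faces c00 l1_norm \<noteq> {}"
  then obtain F H p where H: "H \<in> supporting_hyperplanes c00 l1_norm" "F = unit_ball c00 l1_norm \<inter> H"
    and p: "p \<in> algebraic_interior_rel H F"
    unfolding algebraic_true_faces_def by blast
  obtain f where f: "f \<in> topological_dual c00 l1_norm" "\<And>x. x \<in> c00 \<Longrightarrow> \<bar>f x\<bar> \<le> l1_norm x"
    "H = {x \<in> c00. f x = 1}"
    using l1.supporting_hyperplanesE[OF H(1)] by blast
  have "p \<in> F" using p by (simp add: algebraic_interior_rel_def)
  then have p1: "p \<in> c00" "f p = 1" "l1_norm p = 1"
    using H(2) f(2)[of p] f(3) by (auto simp: unit_ball_def)
  obtain n where n: "p \<in> c00_upto n" using p1(1) by (rule c00_uptoE)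
  define c where "c = f (unit_seq n)"
  \<comment> \<open>A direction along the hyperplane that uses the coordinate \<open>n\<close>, which \<open>p\<close> does not use.\<close>
  define d where "d = unit_seq n - c *\<^sub>R p"
  have d: "d \<in> c00" "f d = 0"
    using p1 subspace_diff[OF subspace_c00] subspace_scale[OF subspace_c00]
      l1.topological_dualD(4)[OF f(1), of "unit_seq n" "c *\<^sub>R p"] l1.topological_dualD(2)[OF f(1) p1(1)]
    by (auto simp: d_def c_def)
  have "p + d \<in> H"
    using f(3) p1 d subspace_add[OF subspace_c00] l1.topological_dualD(1)[OF f(1) p1(1) d(1)] by simp
  then have "\<exists>\<delta>>0. \<forall>t::real. \<bar>t\<bar> \<le> \<delta> \<longrightarrow> p + t *\<^sub>R (p + d - p) \<in> F"
    using p unfolding algebraic_interior_rel_def by blast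
  then obtain \<delta> where \<delta>: "\<delta> > 0" "\<And>t::real. \<bar>t\<bar> \<le> \<delta> \<Longrightarrow> p + t *\<^sub>R d \<in> F"
    by auto
  have "\<bar>t\<bar> \<le> t * c" if t: "\<bar>t\<bar> \<le> \<delta>" for t
  proof -
    have zero: "p n = 0" using n by (simp add: c00_upto_def)
    have "p + t *\<^sub>R d \<in> c00_upto (Suc n)"
      using n by (simp add: d_def c00_upto_def)
    then have "l1_norm (p + t *\<^sub>R d) = (\<Sum>k<Suc n. \<bar>(p + t *\<^sub>R d) k\<bar>)" by (rule l1_norm_eq)
    also have "\<dots> = (\<Sum>k<n. \<bar>1 - t * c\<bar> * \<bar>p k\<bar>) + \<bar>t\<bar>"
      using zero by (simp add: d_def algebra_simps flip: abs_mult)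
    also have "\<dots> = \<bar>1 - t * c\<bar> * l1_norm p + \<bar>t\<bar>"
      by (simp add: l1_norm_eq[OF n] sum_distrib_left)
    finally have "\<bar>1 - t * c\<bar> + \<bar>t\<bar> = l1_norm (p + t *\<^sub>R d)" using p1(3) by simp
    also have "\<dots> \<le> 1" using \<delta>(2)[OF t] H(2) by (simp add: unit_ball_def)
    finally show ?thesis by linarith
  qed
  from this[of \<delta>] this[of "- \<delta>"] have "\<delta> \<le> \<delta> * c" "\<delta> \<le> - (\<delta> * c)"
    using \<open>\<delta> > 0\<close> by simp_all
  then show False using \<open>\<delta> > 0\<close> by linarith
qed

section \<open>A subspace of the convergent sequences\<close>

text \<open>Its value \<open>1\<close> is taken once and then only approached.\<close>

definition profile :: "nat \<Rightarrow> real"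
  where "profile k = (if k = 0 then 1 else 1 - 1 / 2 ^ k)"

text \<open>From index \<open>n\<close> on these sequences are proportional to the profile; the coordinate \<open>0\<close> is the factor.\<close>

definition profile_from :: "nat \<Rightarrow> (nat \<Rightarrow> real) set"
  where "profile_from n = {y. \<forall>k\<ge>n. y k = y 0 * profile k}"

definition profile_space :: "(nat \<Rightarrow> real) set"
  where "profile_space = (\<Union>n. profile_from n)"

definition sup_norm :: "(nat \<Rightarrow> real) \<Rightarrow> real"
  where "sup_norm y = (SUP k. \<bar>y k\<bar>)"

lemma profile_0 [simp]: "profile 0 = 1"
  by (simp add: profile_def)

lemma profile_bounds: "0 \<le> profile k" "profile k \<le> 1"
  by (auto simp: profile_def)

lemma profile_less_1: "k > 0 \<Longrightarrow> profile k < 1"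
  by (simp add: profile_def)

lemma subspace_profile_from: "subspace (profile_from n)"
  by (auto simp: subspace_def profile_from_def algebra_simps)

lemma profile_from_mono: "m \<le> n \<Longrightarrow> profile_from m \<subseteq> profile_from n"
  by (auto simp: profile_from_def)

lemma profile_from_subset: "profile_from n \<subseteq> profile_space"
  by (auto simp: profile_space_def)

lemma profile_fromE:
  assumes "x \<in> profile_space" obtains n where "n > m" "x \<in> profile_from n"
proof -
  obtain n where "x \<in> profile_from n" using assms by (auto simp: profile_space_def)
  then have "x \<in> profile_from (max n (Suc m))"
    using profile_from_mono[of n "max n (Suc m)"] by auto
  then show thesis by (intro that[of "max n (Suc m)"]) auto
qed

lemma subspace_profile_space: "subspace profile_space"
  unfolding subspace_def
proof (intro conjI ballI allI)
  show "0 \<in> profile_space"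
    using subspace_0[OF subspace_profile_from[of 0]] profile_from_subset by blast
  show "c *\<^sub>R x \<in> profile_space" if "x \<in> profile_space" for x and c :: real
    using that by (metis profile_fromE subspace_scale[OF subspace_profile_from] profile_from_subset subsetD)
  fix x y assume "x \<in> profile_space" and "y \<in> profile_space"
  then obtain m n where m: "x \<in> profile_from m" and n: "n > m" "y \<in> profile_from n"
    by (metis profile_fromE)
  then have "x + y \<in> profile_from n"
    using profile_from_mono[of m n] by (intro subspace_add[OF subspace_profile_from]) auto
  then show "x + y \<in> profile_space" using profile_from_subset by blast
qed

lemma unit_seq_in_profile_space: "k > 0 \<Longrightarrow> unit_seq k \<in> profile_space"
proof -
  assume "k > 0"
  then have "unit_seq k \<in> profile_from (Suc k)" by (auto simp: profile_from_def)
  then show ?thesis using profile_from_subset by blast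
qed

text \<open>The first summand is the projection to \<open>profile_from n\<close>.\<close>

lemma profile_expansion:
  assumes y: "y \<in> profile_from m" and n: "n > 0"
  shows "y = (\<lambda>k. if k < n then y k else y 0 * profile k)
    + (\<Sum>k\<in>{n..<m}. (y k - y 0 * profile k) *\<^sub>R unit_seq k)"
proof
  fix i
  have "(\<Sum>k\<in>{n..<m}. (y k - y 0 * profile k) *\<^sub>R unit_seq k) i
      = (\<Sum>k\<in>{n..<m}. if i = k then y k - y 0 * profile k else 0)"
    unfolding sum_fun_apply by (rule sum.cong) auto
  then show "y i = ((\<lambda>k. if k < n then y k else y 0 * profile k)
    + (\<Sum>k\<in>{n..<m}. (y k - y 0 * profile k) *\<^sub>R unit_seq k)) i"
    using y by (auto simp: profile_from_def)
qed

text \<open>The coordinate \<open>0\<close> dominates all coordinates from \<open>n\<close> on; \<open>Suc n\<close> rather than \<open>n\<close> includes it even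
  for \<open>n = 0\<close>.\<close>

lemma sup_norm_le_iff:
  assumes "y \<in> profile_from n"
  shows "sup_norm y \<le> c \<longleftrightarrow> (\<forall>k<Suc n. \<bar>y k\<bar> \<le> c)"
    and "\<bar>y k\<bar> \<le> sup_norm y"
proof -
  have tail: "\<bar>y k\<bar> \<le> \<bar>y 0\<bar>" if "k \<ge> n" for k
    using assms that profile_bounds[of k] by (simp add: profile_from_def abs_mult mult_left_le)
  have "\<bar>y k\<bar> \<le> (\<Sum>i<Suc n. \<bar>y i\<bar>)" for k
  proof (cases "k < Suc n")
    case True
    then show ?thesis by (intro member_le_sum) auto
  next
    case False
    have "\<bar>y 0\<bar> \<le> (\<Sum>i<Suc n. \<bar>y i\<bar>)" by (intro member_le_sum) auto
    then show ?thesis using tail[of k] False by simp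
  qed
  then have bdd: "bdd_above (range (\<lambda>k. \<bar>y k\<bar>))" by (rule bdd_aboveI2)
  show upper: "\<bar>y k\<bar> \<le> sup_norm y" for k
    unfolding sup_norm_def using bdd by (rule cSUP_upper[rotated]) simp
  show "sup_norm y \<le> c \<longleftrightarrow> (\<forall>k<Suc n. \<bar>y k\<bar> \<le> c)"
  proof
    assume "\<forall>k<Suc n. \<bar>y k\<bar> \<le> c"
    then have "\<bar>y k\<bar> \<le> c" for k
      using tail[of k] by (cases "k < Suc n") (auto intro: order_trans[of _ "\<bar>y 0\<bar>"])
    then show "sup_norm y \<le> c" unfolding sup_norm_def by (intro cSUP_least) auto
  qed (use upper in \<open>auto intro: order_trans\<close>)
qed

lemma abs_le_sup_norm: "y \<in> profile_space \<Longrightarrow> \<bar>y k\<bar> \<le> sup_norm y"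
  by (metis profile_fromE sup_norm_le_iff(2))

lemma sup_norm_leI: "(\<And>k. \<bar>y k\<bar> \<le> c) \<Longrightarrow> sup_norm y \<le> c"
  unfolding sup_norm_def by (intro cSUP_least) auto

interpretation sup: normed_space profile_space sup_norm
proof
  show "subspace profile_space" by (rule subspace_profile_space)
next
  fix x assume x: "x \<in> profile_space"
  show "sup_norm x = 0 \<longleftrightarrow> x = 0"
  proof
    assume "sup_norm x = 0"
    then have "x k = 0" for k using abs_le_sup_norm[OF x, of k] by simp
    then show "x = 0" by (simp add: fun_eq_iff)
  qed (simp add: sup_norm_def)
  have le: "sup_norm (c *\<^sub>R x) \<le> \<bar>c\<bar> * sup_norm x" if "x \<in> profile_space" for c x
    using abs_le_sup_norm[OF that] by (intro sup_norm_leI) (simp add: abs_mult mult_left_mono)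
  show "sup_norm (c *\<^sub>R x) = \<bar>c\<bar> * sup_norm x" for c
  proof (cases "c = 0")
    case False
    have "sup_norm ((1 / c) *\<^sub>R (c *\<^sub>R x)) \<le> \<bar>1 / c\<bar> * sup_norm (c *\<^sub>R x)"
      by (intro le subspace_scale[OF subspace_profile_space] x)
    then have "\<bar>c\<bar> * sup_norm x \<le> sup_norm (c *\<^sub>R x)" using False by (simp add: field_simps)
    then show ?thesis using le[OF x] by (simp add: antisym)
  qed (simp add: sup_norm_def)
next
  fix x y assume "x \<in> profile_space" "y \<in> profile_space"
  then show "sup_norm (x + y) \<le> sup_norm x + sup_norm y"
    using abs_le_sup_norm[of x] abs_le_sup_norm[of y]
    by (intro sup_norm_leI) (simp add: order_trans[OF abs_triangle_ineq add_mono])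
qed

lemma polytope_unit_ball_profile_from:
  assumes W: "subspace W" "W \<subseteq> profile_from n"
  shows "polytope (unit_ball W sup_norm)"
proof -
  define I where "I = (\<Union>k<Suc n. {(\<lambda>y :: nat \<Rightarrow> real. y k, 1 :: real), (\<lambda>y. - y k, 1)})"
  have "polytope (solutions W I fst snd)"
  proof (rule polytope_solutions[OF W(1)])
    show "finite I" by (simp add: I_def)
    show "linear (fst i)" if "i \<in> I" for i
      using that linear_eval linear_compose_neg[OF linear_eval] by (auto simp: I_def)
    fix d assume d: "d \<in> W" "d \<noteq> 0"
    show "\<exists>i\<in>I. fst i d > 0"
    proof (rule ccontr)
      assume "\<not> ?thesis"
      then have "d k \<le> 0 \<and> - d k \<le> 0" if "k < Suc n" for k
        using that unfolding I_def by (force simp: not_less)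
      then have zero: "\<forall>k<Suc n. d k = 0" by force
      have "d k = 0" for k
        using zero W(2) d(1) by (cases "k < Suc n") (auto simp: profile_from_def)
      with d(2) show False by (auto simp: fun_eq_iff)
    qed
  qed
  also have "solutions W I fst snd = unit_ball W sup_norm"
  proof -
    have "y \<in> solutions W I fst snd \<longleftrightarrow> y \<in> W \<and> (\<forall>k<Suc n. y k \<le> 1 \<and> - y k \<le> 1)" for y
      unfolding solutions_def I_def by fastforce
    moreover have "y \<in> unit_ball W sup_norm \<longleftrightarrow> y \<in> W \<and> (\<forall>k<Suc n. \<bar>y k\<bar> \<le> 1)" for y
      using W(2) sup_norm_le_iff(1)[of y n 1] by (auto simp: unit_ball_def)
    ultimately show ?thesis unfolding abs_le_iff by blast
  qed
  finally show ?thesis .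
qed

lemma K_polyhedral_sup: "K_polyhedral profile_space sup_norm"
  unfolding K_polyhedral_def
proof (intro allI impI)
  fix W assume W: "subspace W \<and> W \<subseteq> profile_space \<and> (\<exists>B. finite B \<and> span B = W)"
  then obtain B where B: "finite B" "span B = W" by blast
  then have "B \<subseteq> (\<Union>n. profile_from n)" using W span_superset by (force simp: profile_space_def)
  then obtain n where "W \<subseteq> profile_from n"
    using finite_span_subset_chain[of profile_from, OF subspace_profile_from profile_from_mono B(1)] B(2)
    by blast
  then show "polytope (unit_ball W sup_norm)" using W polytope_unit_ball_profile_from by blast
qed

text \<open>A late coordinate of \<open>x\<close> is at most \<open>profile k < 1\<close>, so it can be changed by \<open>1 - profile k\<close> in both
  directions inside the ball, and the norming functional must be constant along this segment.\<close>

lemma norming_functional_vanishes: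
  assumes x: "x \<in> unit_sphere profile_space sup_norm" "x \<in> profile_from n"
    and f: "f \<in> norming_functionals profile_space sup_norm x" and k: "k \<ge> n" "k > 0"
  shows "f (unit_seq k) = 0"
proof -
  have x': "x \<in> profile_space" "sup_norm x = 1" using x by (auto simp: unit_sphere_def)
  have f': "f \<in> topological_dual profile_space sup_norm" "f x = 1"
    "\<And>y. y \<in> profile_space \<Longrightarrow> \<bar>f y\<bar> \<le> sup_norm y"
    using f unfolding sup.norming_functionals_eq[OF x(1)] sup.dual_ball_iff by auto
  note ek = unit_seq_in_profile_space[OF k(2)]
  have "1 + c * f (unit_seq k) \<le> 1" if c: "\<bar>c\<bar> = 1 - profile k" for c
  proof -
    have ce: "c *\<^sub>R unit_seq k \<in> profile_space" using ek subspace_scale[OF subspace_profile_space] by blast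
    have "\<bar>(x + c *\<^sub>R unit_seq k) i\<bar> \<le> 1" for i
    proof (cases "i = k")
      case True
      have "\<bar>x k\<bar> = \<bar>x 0\<bar> * profile k"
        using x(2) k(1) profile_bounds by (simp add: profile_from_def abs_mult)
      also have "\<dots> \<le> 1 * profile k"
        using abs_le_sup_norm[OF x'(1), of 0] x'(2) profile_bounds by (intro mult_right_mono) auto
      finally show ?thesis using c True by simp
    next
      case False
      then show ?thesis using abs_le_sup_norm[OF x'(1), of i] x'(2) by simp
    qed
    then have "sup_norm (x + c *\<^sub>R unit_seq k) \<le> 1" by (rule sup_norm_leI)
    moreover have "f (x + c *\<^sub>R unit_seq k) = 1 + c * f (unit_seq k)"
      using sup.topological_dualD(1)[OF f'(1) x'(1) ce] sup.topological_dualD(2)[OF f'(1) ek] f'(2) by simp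
    moreover have "\<bar>f (x + c *\<^sub>R unit_seq k)\<bar> \<le> sup_norm (x + c *\<^sub>R unit_seq k)"
      using x'(1) ce subspace_add[OF subspace_profile_space] by (intro f'(3)) auto
    ultimately show ?thesis by linarith
  qed
  from this[of "1 - profile k"] this[of "- (1 - profile k)"] have "(1 - profile k) * f (unit_seq k) = 0"
    using profile_bounds[of k] by (simp add: algebra_simps)
  then show ?thesis using profile_less_1[OF k(2)] by simp
qed

text \<open>Norming functionals at \<open>x\<close> vanish on the unit vectors from some \<open>n\<close> on. Among such functionals they
  are characterized by finitely many inequalities: \<open>f v \<le> 1\<close> for the vertices \<open>v\<close> of the ball of the
  finite-dimensional space \<open>profile_from n\<close>, and \<open>f x \<ge> 1\<close>. A system of this kind has finitely many
  extreme solutions.\<close>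

lemma property_Delta_sup: "property_Delta profile_space sup_norm"
  unfolding property_Delta_def
proof
  fix x assume x: "x \<in> unit_sphere profile_space sup_norm"
  have x': "x \<in> profile_space" "sup_norm x = 1" using x by (auto simp: unit_sphere_def)
  obtain n where n: "n > 0" "x \<in> profile_from n" using x'(1) by (rule profile_fromE)
  have "\<exists>S. finite S \<and> unit_ball (profile_from n) sup_norm = convex hull S"
    using polytope_unit_ball_profile_from[OF subspace_profile_from[of n] order_refl]
    unfolding polytope_def .
  then obtain S where S: "finite S" "unit_ball (profile_from n) sup_norm = convex hull S"
    by blast
  have S_sub: "S \<subseteq> unit_ball (profile_from n) sup_norm" unfolding S(2) by (rule hull_subset)
  define Y where "Y = {f \<in> topological_dual profile_space sup_norm. \<forall>k\<ge>n. f (unit_seq k) = 0}"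
  define J where "J = (\<lambda>v. (\<lambda>f :: (nat \<Rightarrow> real) \<Rightarrow> real. f v, 1)) ` S \<union> {(\<lambda>f. - f x, -1 :: real)}"
  note sub = sup.subspace_topological_dual
  have Y: "subspace Y"
    unfolding subspace_def Y_def
    using subspace_0[OF sub] subspace_add[OF sub] subspace_scale[OF sub] by simp
  have fin: "finite (extreme_points (solutions Y J fst snd))"
  proof (rule finite_extreme_points_solutions[OF Y])
    show "finite J" using S(1) by (simp add: J_def)
    show "linear (fst i)" if "i \<in> J" for i
      using that linear_eval linear_compose_neg[OF linear_eval] by (auto simp: J_def)
  qed
  have "norming_functionals profile_space sup_norm x = solutions Y J fst snd"
  proof (intro equalityI subsetI)
    fix f assume f: "f \<in> norming_functionals profile_space sup_norm x"
    then have f': "f \<in> topological_dual profile_space sup_norm" "f x = 1"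
      "\<And>y. y \<in> profile_space \<Longrightarrow> \<bar>f y\<bar> \<le> sup_norm y"
      unfolding sup.norming_functionals_eq[OF x] sup.dual_ball_iff by auto
    have "f v \<le> 1" if "v \<in> S" for v
    proof -
      have "v \<in> profile_space" "sup_norm v \<le> 1"
        using that S_sub profile_from_subset by (auto simp: unit_ball_def)
      then show ?thesis using f'(3)[of v] by linarith
    qed
    then show "f \<in> solutions Y J fst snd"
      using f' norming_functional_vanishes[OF x n(2) f] n(1) by (auto simp: solutions_def Y_def J_def)
  next
    fix f assume "f \<in> solutions Y J fst snd"
    then have f: "f \<in> topological_dual profile_space sup_norm" "\<And>k. k \<ge> n \<Longrightarrow> f (unit_seq k) = 0"
      "\<And>v. v \<in> S \<Longrightarrow> f v \<le> 1" "f x \<ge> 1"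
      by (auto simp: solutions_def Y_def J_def)
    note flin = sup.topological_dualD[OF f(1)]
    have hull: "f z \<le> 1" if "z \<in> unit_ball (profile_from n) sup_norm" for z
    proof -
      have "convex {z \<in> profile_from n. f z \<le> 1}"
      proof (rule convexI)
        fix a b and s t :: real
        assume ab: "a \<in> {z \<in> profile_from n. f z \<le> 1}" "b \<in> {z \<in> profile_from n. f z \<le> 1}"
          and st: "0 \<le> s" "0 \<le> t" "s + t = 1"
        have ab': "a \<in> profile_space" "b \<in> profile_space" using ab profile_from_subset by auto
        have "f (s *\<^sub>R a + t *\<^sub>R b) = s * f a + t * f b"
          using ab' flin(1,2) subspace_scale[OF subspace_profile_space] by simp
        also have "\<dots> \<le> 1" using ab st by (intro convex_bound_le) auto
        finally show "s *\<^sub>R a + t *\<^sub>R b \<in> {z \<in> profile_from n. f z \<le> 1}"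
          using ab subspace_add[OF subspace_profile_from] subspace_scale[OF subspace_profile_from] by auto
      qed
      moreover have "S \<subseteq> {z \<in> profile_from n. f z \<le> 1}"
        using S_sub f(3) by (auto simp: unit_ball_def)
      ultimately have "convex hull S \<subseteq> {z \<in> profile_from n. f z \<le> 1}" by (intro hull_minimal)
      then show ?thesis using that S(2) by auto
    qed
    have le: "f y \<le> sup_norm y" if y: "y \<in> profile_space" for y
    proof -
      obtain m where m: "y \<in> profile_from m" using y by (auto simp: profile_space_def)
      \<comment> \<open>\<open>z\<close> is the projection of \<open>y\<close> to \<open>profile_from n\<close>; it does not increase the norm, and
        \<open>f\<close> does not distinguish \<open>z\<close> from \<open>y\<close>.\<close>
      define z where "z = (\<lambda>k. if k < n then y k else y 0 * profile k)"
      have z: "z \<in> profile_from n" using n(1) by (simp add: z_def profile_from_def)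
      then have zV: "z \<in> profile_space" using profile_from_subset by blast
      have "\<bar>z k\<bar> \<le> sup_norm y" for k
      proof (cases "k < n")
        case True
        then show ?thesis using abs_le_sup_norm[OF y] by (simp add: z_def)
      next
        case False
        then have "\<bar>z k\<bar> \<le> \<bar>y 0\<bar>" using profile_bounds by (simp add: z_def abs_mult mult_left_le)
        then show ?thesis using abs_le_sup_norm[OF y, of 0] by linarith
      qed
      then have zy: "sup_norm z \<le> sup_norm y" by (rule sup_norm_leI)
      have sum: "(\<Sum>k\<in>{n..<m}. (y k - y 0 * profile k) *\<^sub>R unit_seq k) \<in> profile_space \<and>
          f (\<Sum>k\<in>{n..<m}. (y k - y 0 * profile k) *\<^sub>R unit_seq k)
            = (\<Sum>k\<in>{n..<m}. (y k - y 0 * profile k) * f (unit_seq k))"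
        using n(1) by (intro sup.functional_sum[OF f(1)] unit_seq_in_profile_space) auto
      also have "(\<Sum>k\<in>{n..<m}. (y k - y 0 * profile k) * f (unit_seq k)) = 0"
        using f(2) by (intro sum.neutral) auto
      finally have "f y = f z"
        using flin(1)[OF zV] profile_expansion[OF m n(1)] unfolding z_def by (metis add.right_neutral)
      also have "f z \<le> sup_norm z"
      proof (cases "z = 0")
        case True
        then show ?thesis using flin(6) by simp
      next
        case False
        then have pos: "sup_norm z > 0" using zV by (intro sup.norm_pos) auto
        have "(1 / sup_norm z) *\<^sub>R z \<in> unit_ball (profile_from n) sup_norm"
          using z zV pos sup.norm_scaleR subspace_scale[OF subspace_profile_from]
          by (simp add: unit_ball_def)
        from hull[OF this] show ?thesis using pos flin(2)[OF zV] by (simp add: field_simps)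
      qed
      finally show ?thesis using zy by linarith
    qed
    have "\<bar>f y\<bar> \<le> sup_norm y" if y: "y \<in> profile_space" for y
      using le[OF y] le[of "- y"] flin(5)[OF y] sup.norm_minus[OF y] subspace_neg[OF subspace_profile_space y]
      by auto
    then show "f \<in> norming_functionals profile_space sup_norm x"
      using f(1,4) x' le[of x] unfolding sup.norming_functionals_eq[OF x] sup.dual_ball_iff by auto
  qed
  then show "finite (extreme_points (norming_functionals profile_space sup_norm x))" using fin by simp
qed

lemma profile_in_unit_sphere: "profile \<in> unit_sphere profile_space sup_norm"
proof -
  have 0: "profile \<in> profile_from 0" by (simp add: profile_from_def)
  then have "profile \<in> profile_space" using profile_from_subset by blast
  moreover have "sup_norm profile \<le> 1" using sup_norm_le_iff(1)[OF 0] by simp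
  moreover have "1 \<le> sup_norm profile" using sup_norm_le_iff(2)[OF 0, of 0] by simp
  ultimately show ?thesis by (simp add: unit_sphere_def)
qed

text \<open>The only functional norming at the profile is the coordinate \<open>0\<close>, so a point \<open>p\<close> of its face has
  \<open>p 0 = 1\<close> and late coordinates \<open>1 - 1/2\<^sup>k\<close>. Increasing such a coordinate by \<open>\<rho>/2\<close> stays on the
  hyperplane and within distance \<open>\<rho>\<close>, but leaves the ball.\<close>

lemma profile_not_in_true_face: "profile \<notin> \<Union> (true_faces profile_space sup_norm)"
proof
  assume "profile \<in> \<Union> (true_faces profile_space sup_norm)"
  then obtain F H p where H: "H \<in> supporting_hyperplanes profile_space sup_norm"
      "F = unit_ball profile_space sup_norm \<inter> H" "profile \<in> F"
    and p: "p \<in> subtopology (norm_topology profile_space sup_norm) H interior_of F"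
    unfolding true_faces_def by blast
  obtain \<rho> where \<rho>: "\<rho> > 0" "p \<in> profile_space" "p \<in> H"
    "\<And>y. \<lbrakk>y \<in> profile_space; y \<in> H; sup_norm (y - p) < \<rho>\<rbrakk> \<Longrightarrow> y \<in> F"
    using sup.interior_of_face_ball[OF p] by blast
  obtain f where f: "f \<in> topological_dual profile_space sup_norm"
    "\<And>x. x \<in> profile_space \<Longrightarrow> \<bar>f x\<bar> \<le> sup_norm x" "H = {x \<in> profile_space. f x = 1}"
    using sup.supporting_hyperplanesE[OF H(1)] by blast
  note flin = sup.topological_dualD[OF f(1)]
  have u: "profile \<in> profile_space" "f profile = 1" using H f(3) by auto
  have "f \<in> norming_functionals profile_space sup_norm profile"
    using f u unfolding sup.norming_functionals_eq[OF profile_in_unit_sphere] sup.dual_ball_iff by auto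
  then have fe: "f (unit_seq k) = 0" if "k > 0" for k
    using that by (intro norming_functional_vanishes[OF profile_in_unit_sphere, of 0])
      (auto simp: profile_from_def)
  obtain n where n: "n > 0" "p \<in> profile_from n" using \<rho>(2) by (rule profile_fromE)
  let ?s = "\<Sum>k\<in>{1..<n}. (p k - p 0 * profile k) *\<^sub>R unit_seq k"
  have "?s \<in> profile_space \<and> f ?s = (\<Sum>k\<in>{1..<n}. (p k - p 0 * profile k) * f (unit_seq k))"
    by (intro sup.functional_sum[OF f(1)] unit_seq_in_profile_space) auto
  also have "(\<Sum>k\<in>{1..<n}. (p k - p 0 * profile k) * f (unit_seq k)) = 0"
    using fe by (intro sum.neutral) auto
  finally have sum0: "?s \<in> profile_space" "f ?s = 0"
    by blast+
  have "(\<lambda>k. if k < 1 then p k else p 0 * profile k) = p 0 *\<^sub>R profile" by auto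
  then have "p = p 0 *\<^sub>R profile + ?s"
    using profile_expansion[OF n(2), of 1] by simp
  then have "f p = f (p 0 *\<^sub>R profile) + 0"
    using flin(1)[OF subspace_scale[OF subspace_profile_space u(1)] sum0(1)] sum0(2) by metis
  then have p0: "p 0 = 1" using flin(2)[OF u(1)] u(2) \<rho>(3) f(3) by simp
  obtain k0 :: nat where k0: "(1/2) ^ k0 < \<rho> / 2"
    using real_arch_pow_inv[of "\<rho> / 2" "1/2"] \<rho>(1) by auto
  define k where "k = max k0 n"
  have k: "k \<ge> n" "k > 0" using n(1) by (auto simp: k_def)
  have "(1/2 :: real) ^ k \<le> (1/2) ^ k0" unfolding k_def by (rule power_decreasing) auto
  then have gap: "1 / 2 ^ k < \<rho> / 2" using k0 by (simp add: power_divide)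
  have e: "(\<rho> / 2) *\<^sub>R unit_seq k \<in> profile_space"
    using unit_seq_in_profile_space[OF k(2)] subspace_scale[OF subspace_profile_space] by blast
  let ?y = "p + (\<rho> / 2) *\<^sub>R unit_seq k"
  have y: "?y \<in> profile_space" using \<rho>(2) e subspace_add[OF subspace_profile_space] by blast
  have "sup_norm ((\<rho> / 2) *\<^sub>R unit_seq k) \<le> \<rho> / 2" using \<rho>(1) by (intro sup_norm_leI) simp
  then have "sup_norm (?y - p) < \<rho>" using \<rho>(1) by simp
  moreover have "f ?y = 1"
    using flin(1)[OF \<rho>(2) e] flin(2)[OF unit_seq_in_profile_space[OF k(2)]] fe[OF k(2)] \<rho>(3) f(3) by simp
  ultimately have "?y \<in> F" using y f(3) by (intro \<rho>(4)) auto
  then have "\<bar>?y k\<bar> \<le> 1" using abs_le_sup_norm[OF y, of k] H(2) by (simp add: unit_ball_def)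
  moreover have "?y k = 1 - 1 / 2 ^ k + \<rho> / 2"
    using n(2) k p0 by (simp add: profile_from_def profile_def)
  ultimately show False using gap by linarith
qed

section \<open>Support functionals of seminorms\<close>

text \<open>Sublinear functionals are taken on the whole type, so that no partially defined linear functional
  has to be extended.\<close>

definition sublinear :: "('a::real_vector \<Rightarrow> real) \<Rightarrow> bool"
  where "sublinear P \<longleftrightarrow> (\<forall>x y. P (x + y) \<le> P x + P y) \<and> (\<forall>c\<ge>0. \<forall>x. P (c *\<^sub>R x) = c * P x)"

lemma sublinear_add: "sublinear P \<Longrightarrow> P (x + y) \<le> P x + P y"
  and sublinear_scale: "\<lbrakk>sublinear P; c \<ge> 0\<rbrakk> \<Longrightarrow> P (c *\<^sub>R x) = c * P x"
  by (auto simp: sublinear_def)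

lemma sublinear_0: "sublinear P \<Longrightarrow> P 0 = 0"
  using sublinear_scale[of P 0 0] by simp

lemma sublinear_minus: "sublinear P \<Longrightarrow> - P x \<le> P (- x)"
  using sublinear_add[of P x "- x"] sublinear_0[of P] by simp

text \<open>The largest sublinear functional below \<open>P\<close> that is linear along \<open>e\<close> with the value \<open>P e\<close>.\<close>

definition linearize :: "('a::real_vector \<Rightarrow> real) \<Rightarrow> 'a \<Rightarrow> 'a \<Rightarrow> real"
  where "linearize P e x = (INF t\<in>{0..}. P (x + t *\<^sub>R e) - t * P e)"

lemma linearize_le:
  assumes P: "sublinear P" and "t \<ge> 0"
  shows "linearize P e x \<le> P (x + t *\<^sub>R e) - t * P e"
proof -
  have "- P (- x) \<le> P (x + t *\<^sub>R e) - t * P e" if "t \<ge> 0" for t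
    using sublinear_add[OF P, of "x + t *\<^sub>R e" "- x"] sublinear_scale[OF P that, of e] by simp
  then have "bdd_below ((\<lambda>t. P (x + t *\<^sub>R e) - t * P e) ` {0..})"
    by (intro bdd_belowI2[of _ "- P (- x)"]) auto
  then show ?thesis
    unfolding linearize_def using assms(2) by (intro cINF_lower) auto
qed

lemma linearize_greatest:
  assumes "\<And>t. t \<ge> 0 \<Longrightarrow> a \<le> P (x + t *\<^sub>R e) - t * P e"
  shows "a \<le> linearize P e x"
  unfolding linearize_def using assms by (intro cINF_greatest) auto

lemma sublinear_linearize:
  assumes P: "sublinear P"
  shows "sublinear (linearize P e)"
  unfolding sublinear_def
proof (intro conjI allI impI)
  fix x y
  have "linearize P e (x + y) - (P (x + s *\<^sub>R e) - s * P e) \<le> P (y + t *\<^sub>R e) - t * P e"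
    if st: "s \<ge> 0" "t \<ge> 0" for s t
  proof -
    have "linearize P e (x + y) \<le> P (x + y + (s + t) *\<^sub>R e) - (s + t) * P e"
      using st by (intro linearize_le[OF P]) auto
    also have "x + y + (s + t) *\<^sub>R e = (x + s *\<^sub>R e) + (y + t *\<^sub>R e)" by (simp add: algebra_simps)
    finally show ?thesis
      using sublinear_add[OF P, of "x + s *\<^sub>R e" "y + t *\<^sub>R e"] by (simp add: algebra_simps)
  qed
  then have "linearize P e (x + y) - (P (x + s *\<^sub>R e) - s * P e) \<le> linearize P e y" if "s \<ge> 0" for s
    using that by (intro linearize_greatest) auto
  then have "linearize P e (x + y) - linearize P e y \<le> P (x + s *\<^sub>R e) - s * P e" if "s \<ge> 0" for s
    using that by (simp add: algebra_simps)
  then have "linearize P e (x + y) - linearize P e y \<le> linearize P e x" by (rule linearize_greatest)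
  then show "linearize P e (x + y) \<le> linearize P e x + linearize P e y" by simp
next
  have le: "linearize P e (c *\<^sub>R x) \<le> c * linearize P e x" if c: "c > 0" for c x
  proof -
    have "linearize P e (c *\<^sub>R x) / c \<le> P (x + t *\<^sub>R e) - t * P e" if t: "t \<ge> 0" for t
    proof -
      have "linearize P e (c *\<^sub>R x) \<le> P (c *\<^sub>R x + (c * t) *\<^sub>R e) - (c * t) * P e"
        using c t by (intro linearize_le[OF P]) auto
      also have "c *\<^sub>R x + (c * t) *\<^sub>R e = c *\<^sub>R (x + t *\<^sub>R e)" by (simp add: algebra_simps)
      also have "P \<dots> = c * P (x + t *\<^sub>R e)" using c by (intro sublinear_scale[OF P]) auto
      finally show ?thesis using c by (simp add: field_simps)
    qed
    then have "linearize P e (c *\<^sub>R x) / c \<le> linearize P e x" by (rule linearize_greatest)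
    then show ?thesis using c by (simp add: field_simps)
  qed
  fix c :: real and x assume "c \<ge> 0"
  show "linearize P e (c *\<^sub>R x) = c * linearize P e x"
  proof (cases "c = 0")
    case True
    have "linearize P e 0 \<le> 0" using linearize_le[OF P, of 0 e 0] sublinear_0[OF P] by simp
    moreover have "0 \<le> linearize P e 0"
      using sublinear_scale[OF P, of _ e] by (intro linearize_greatest) simp
    ultimately show ?thesis using True by simp
  next
    case False
    then have c: "c > 0" using \<open>c \<ge> 0\<close> by simp
    have "linearize P e ((1 / c) *\<^sub>R (c *\<^sub>R x)) \<le> (1 / c) * linearize P e (c *\<^sub>R x)"
      using c by (intro le) auto
    then have "c * linearize P e x \<le> linearize P e (c *\<^sub>R x)" using c by (simp add: field_simps)
    then show ?thesis using le[OF c, of x] by simp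
  qed
qed

text \<open>A sublinear minorant keeps every direction of linearity, and its value there. So linearity can be
  achieved one direction after the other.\<close>

lemma linear_direction_preserved:
  assumes "sublinear P" "sublinear Q" "\<And>x. Q x \<le> P x" "P (- e) \<le> - P e"
  shows "Q e = P e" "Q (- e) = - Q e"
  using sublinear_minus[OF assms(2), of e] assms(3)[of e] assms(3)[of "- e"] assms(4) by linarith+

lemma sublinear_linear_on_finite:
  assumes "finite E" "sublinear P"
  shows "\<exists>Q. sublinear Q \<and> (\<forall>x. Q x \<le> P x) \<and> (\<forall>e\<in>E. Q (- e) = - Q e)"
  using assms
proof (induction E arbitrary: P rule: finite_induct)
  case empty
  then show ?case by blast
next
  case (insert e E)
  let ?P = "linearize P e"
  have P: "sublinear ?P" using insert.prems by (rule sublinear_linearize)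
  have le: "?P x \<le> P x" for x using linearize_le[OF insert.prems, of 0 e x] by simp
  have "?P (- e) \<le> - P e"
    using linearize_le[OF insert.prems, of 1 e "- e"] sublinear_0[OF insert.prems] by simp
  also have "\<dots> \<le> - ?P e" using le by simp
  finally have e: "?P (- e) \<le> - ?P e" .
  obtain Q where Q: "sublinear Q" "\<And>x. Q x \<le> ?P x" "\<forall>e\<in>E. Q (- e) = - Q e"
    using insert.IH[OF P] by blast
  have "Q (- e) = - Q e" using linear_direction_preserved(2)[OF P Q(1,2) e] .
  with Q le show ?case by (intro exI[of _ Q]) (auto intro: order_trans)
qed

lemma sublinear_linear_subspace:
  assumes Q: "sublinear Q"
  shows "subspace {x. Q (- x) = - Q x}"
    and "\<lbrakk>Q (- x) = - Q x; Q (- y) = - Q y\<rbrakk> \<Longrightarrow> Q (x + y) = Q x + Q y"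
    and "Q (- x) = - Q x \<Longrightarrow> Q (c *\<^sub>R x) = c * Q x"
proof -
  show add: "Q (x + y) = Q x + Q y" if "Q (- x) = - Q x" "Q (- y) = - Q y" for x y
    using sublinear_add[OF Q, of x y] sublinear_add[OF Q, of "x + y" "- y"] that by simp
  show scale: "Q (c *\<^sub>R x) = c * Q x" if "Q (- x) = - Q x" for c x
    using sublinear_scale[OF Q, of c x] sublinear_scale[OF Q, of "- c" "- x"] that
    by (cases "c \<ge> 0") auto
  show "subspace {x. Q (- x) = - Q x}"
    unfolding subspace_def
  proof (intro conjI ballI allI)
    show "0 \<in> {x. Q (- x) = - Q x}" using sublinear_0[OF Q] by simp
    fix x assume "x \<in> {x. Q (- x) = - Q x}"
    then have x: "Q (- x) = - Q x" "Q (- (- x)) = - Q (- x)" by auto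
    show "c *\<^sub>R x \<in> {x. Q (- x) = - Q x}" for c
      using scale[OF x(1), of "- c"] scale[OF x(1), of c] by simp
    fix y assume "y \<in> {x. Q (- x) = - Q x}"
    then have y: "Q (- y) = - Q y" "Q (- (- y)) = - Q (- y)" by auto
    show "x + y \<in> {x. Q (- x) = - Q x}"
      using add[OF x(1) y(1)] add[OF x(2) y(2)] x(1) y(1) by simp
  qed
qed

definition seminorm :: "('a::real_vector \<Rightarrow> real) \<Rightarrow> bool"
  where "seminorm P \<longleftrightarrow> (\<forall>x y. P (x + y) \<le> P x + P y) \<and> (\<forall>c x. P (c *\<^sub>R x) = \<bar>c\<bar> * P x)"

lemma seminorm_add: "seminorm P \<Longrightarrow> P (x + y) \<le> P x + P y"
  and seminorm_scale: "seminorm P \<Longrightarrow> P (c *\<^sub>R x) = \<bar>c\<bar> * P x"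
  by (auto simp: seminorm_def)

lemma seminorm_0: "seminorm P \<Longrightarrow> P 0 = 0"
  using seminorm_scale[of P 0 0] by simp

lemma seminorm_minus: "seminorm P \<Longrightarrow> P (- x) = P x"
  using seminorm_scale[of P "-1" x] by simp

lemma seminorm_nonneg: "seminorm P \<Longrightarrow> 0 \<le> P x"
  using seminorm_add[of P x "- x"] seminorm_0[of P] seminorm_minus[of P x] by simp

lemma seminorm_add_null: "\<lbrakk>seminorm P; P z = 0\<rbrakk> \<Longrightarrow> P (x + z) = P x"
  using seminorm_add[of P x z] seminorm_add[of P "x + z" "- z"] seminorm_minus[of P z] by simp

text \<open>A Hahn--Banach theorem for seminorms with a finite-dimensional quotient. Linearizing first along
  \<open>a\<close> fixes the value there; linearizing along \<open>E\<close> then leaves no freedom, because the remaining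
  directions are in the kernel of \<open>P\<close>.\<close>

lemma seminorm_support_functional:
  assumes P: "seminorm P" and E: "finite E" "\<And>x. \<exists>y\<in>span E. P (x - y) = 0"
  shows "\<exists>g. linear g \<and> (\<forall>x. \<bar>g x\<bar> \<le> P x) \<and> g a = P a"
proof -
  have sub: "sublinear P" using P by (auto simp: sublinear_def seminorm_def)
  let ?P = "linearize P a"
  have P': "sublinear ?P" using sub by (rule sublinear_linearize)
  have le: "?P x \<le> P x" for x using linearize_le[OF sub, of 0 a x] by simp
  have "?P (- a) \<le> - P a"
    using linearize_le[OF sub, of 1 a "- a"] sublinear_0[OF sub] by simp
  then have a: "?P (- a) \<le> - ?P a" "P a \<le> ?P a"
    using le[of a] sublinear_minus[OF P', of a] by linarith+
  obtain Q where Q: "sublinear Q" "\<And>x. Q x \<le> ?P x" "\<forall>e\<in>E. Q (- e) = - Q e"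
    using sublinear_linear_on_finite[OF E(1) P'] by blast
  have QP: "Q x \<le> P x" for x using Q(2)[of x] le[of x] by linarith
  have Qa: "Q a = P a" using linear_direction_preserved(1)[OF P' Q(1,2) a(1)] a(2) le[of a] by linarith
  note lin = sublinear_linear_subspace[OF Q(1)]
  have all: "Q (- x) = - Q x" for x
  proof -
    obtain y where y: "y \<in> span E" "P (x - y) = 0" using E(2) by blast
    have "span E \<subseteq> {x. Q (- x) = - Q x}" using lin(1) Q(3) by (intro span_minimal) auto
    then have "y \<in> {x. Q (- x) = - Q x}" using y(1) by blast
    moreover have "x - y \<in> {x. Q (- x) = - Q x}"
      using QP[of "x - y"] QP[of "- (x - y)"] y(2) seminorm_minus[OF P, of "x - y"]
        sublinear_minus[OF Q(1), of "x - y"] by simp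
    ultimately have "y + (x - y) \<in> {x. Q (- x) = - Q x}" by (rule subspace_add[OF lin(1)])
    then show ?thesis by simp
  qed
  have "linear Q" using lin(2,3) all by (intro linearI) auto
  moreover have "\<bar>Q x\<bar> \<le> P x" for x
    using QP[of x] QP[of "- x"] all[of x] seminorm_minus[OF P, of x] by linarith
  ultimately show ?thesis using Qa by blast
qed

section \<open>Adjoining vertices in a new dimension\<close>

text \<open>Suppose that \<open>P e = 0\<close>, that \<open>h\<close> is the coordinate along \<open>e\<close>, and that \<open>h p = 0\<close>.
  This is the gauge of the convex hull
  of the ball of \<open>P\<close> (in the kernel of \<open>h\<close>) with \<open>\<plusminus>e\<close> and \<open>\<plusminus>(p + \<epsilon> e)\<close>: here \<open>s\<close> is the
  coefficient of \<open>p + \<epsilon> e\<close>, and \<open>h x - s * \<epsilon>\<close> is what remains for \<open>e\<close>.\<close>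

definition adjoin :: "('a::real_vector \<Rightarrow> real) \<Rightarrow> 'a \<Rightarrow> ('a \<Rightarrow> real) \<Rightarrow> real \<Rightarrow> 'a \<Rightarrow> real"
  where "adjoin P p h \<epsilon> x = (INF s. P (x - s *\<^sub>R p) + \<bar>s\<bar> + \<bar>h x - s * \<epsilon>\<bar>)"

context
  fixes P :: "'a::real_vector \<Rightarrow> real" and p :: 'a and h :: "'a \<Rightarrow> real" and \<epsilon> :: real
  assumes P: "seminorm P" and p: "P p \<le> 1" and h: "linear h"
begin

lemma adjoin_le: "adjoin P p h \<epsilon> x \<le> P (x - s *\<^sub>R p) + \<bar>s\<bar> + \<bar>h x - s * \<epsilon>\<bar>"
  unfolding adjoin_def
  by (intro cINF_lower bdd_belowI2[of _ 0]) (auto intro!: add_nonneg_nonneg seminorm_nonneg[OF P])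

text \<open>The objective is continuous in \<open>s\<close> and at least \<open>\<bar>s\<bar>\<close>, so its infimum is attained on the compact
  interval bounded by its value at \<open>0\<close>.\<close>

lemma adjoin_attained: "\<exists>s. adjoin P p h \<epsilon> x = P (x - s *\<^sub>R p) + \<bar>s\<bar> + \<bar>h x - s * \<epsilon>\<bar>"
proof -
  define \<phi> where "\<phi> s = P (x - s *\<^sub>R p) + \<bar>s\<bar> + \<bar>h x - s * \<epsilon>\<bar>" for s
  have diff: "P (x - s *\<^sub>R p) - P (x - t *\<^sub>R p) \<le> \<bar>s - t\<bar>" for s t
  proof -
    have "x - s *\<^sub>R p = (x - t *\<^sub>R p) + (t - s) *\<^sub>R p" by (simp add: algebra_simps)
    then have "P (x - s *\<^sub>R p) \<le> P (x - t *\<^sub>R p) + \<bar>t - s\<bar> * P p"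
      using seminorm_add[OF P, of "x - t *\<^sub>R p" "(t - s) *\<^sub>R p"] seminorm_scale[OF P] by metis
    also have "\<bar>t - s\<bar> * P p \<le> \<bar>t - s\<bar> * 1" using p by (intro mult_left_mono) auto
    finally show ?thesis by (simp add: abs_minus_commute)
  qed
  have "continuous_on A (\<lambda>s. P (x - s *\<^sub>R p))" for A
    unfolding continuous_on_iff
  proof (intro ballI allI impI)
    fix s e :: real assume "e > 0"
    moreover have "dist (P (x - t *\<^sub>R p)) (P (x - s *\<^sub>R p)) \<le> dist t s" for t
      using diff[of t s] diff[of s t] by (auto simp: dist_real_def abs_le_iff)
    ultimately show "\<exists>d>0. \<forall>t\<in>A. dist t s < d \<longrightarrow> dist (P (x - t *\<^sub>R p)) (P (x - s *\<^sub>R p)) < e"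
      by (meson le_less_trans)
  qed
  then have "continuous_on {- \<phi> 0..\<phi> 0} \<phi>" unfolding \<phi>_def by (intro continuous_intros)
  moreover have nonneg: "\<bar>s\<bar> \<le> \<phi> s" for s using seminorm_nonneg[OF P] by (simp add: \<phi>_def)
  then have "0 \<in> {- \<phi> 0..\<phi> 0}" using nonneg[of 0] by auto
  ultimately obtain s where s: "s \<in> {- \<phi> 0..\<phi> 0}" "\<And>t. t \<in> {- \<phi> 0..\<phi> 0} \<Longrightarrow> \<phi> s \<le> \<phi> t"
    using continuous_attains_inf[of "{- \<phi> 0..\<phi> 0}" \<phi>] by auto
  have "\<phi> s \<le> \<phi> t" for t
  proof (cases "\<bar>t\<bar> \<le> \<phi> 0")
    case True
    then show ?thesis by (intro s(2)) auto
  next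
    case False
    then show ?thesis using s(2)[OF \<open>0 \<in> _\<close>] nonneg[of t] by linarith
  qed
  then have "\<phi> s \<le> adjoin P p h \<epsilon> x" unfolding adjoin_def \<phi>_def by (intro cINF_greatest) auto
  then show ?thesis using adjoin_le[of x s] by (intro exI[of _ s]) (simp add: \<phi>_def)
qed

lemma seminorm_adjoin: "seminorm (adjoin P p h \<epsilon>)"
  unfolding seminorm_def
proof (intro conjI allI)
  fix x y
  obtain s t where s: "adjoin P p h \<epsilon> x = P (x - s *\<^sub>R p) + \<bar>s\<bar> + \<bar>h x - s * \<epsilon>\<bar>"
    and t: "adjoin P p h \<epsilon> y = P (y - t *\<^sub>R p) + \<bar>t\<bar> + \<bar>h y - t * \<epsilon>\<bar>"
    using adjoin_attained by blast
  have "adjoin P p h \<epsilon> (x + y) \<le>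
      P (x + y - (s + t) *\<^sub>R p) + \<bar>s + t\<bar> + \<bar>h (x + y) - (s + t) * \<epsilon>\<bar>" by (rule adjoin_le)
  also have "x + y - (s + t) *\<^sub>R p = (x - s *\<^sub>R p) + (y - t *\<^sub>R p)" by (simp add: algebra_simps)
  also have "h (x + y) - (s + t) * \<epsilon> = (h x - s * \<epsilon>) + (h y - t * \<epsilon>)"
    using h by (simp add: linear_add algebra_simps)
  finally show "adjoin P p h \<epsilon> (x + y) \<le> adjoin P p h \<epsilon> x + adjoin P p h \<epsilon> y"
    using seminorm_add[OF P, of "x - s *\<^sub>R p" "y - t *\<^sub>R p"] s t
      abs_triangle_ineq[of s t] abs_triangle_ineq[of "h x - s * \<epsilon>" "h y - t * \<epsilon>"]
    by linarith
next
  have le: "adjoin P p h \<epsilon> (c *\<^sub>R x) \<le> \<bar>c\<bar> * adjoin P p h \<epsilon> x" for c x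
  proof -
    obtain s where s: "adjoin P p h \<epsilon> x = P (x - s *\<^sub>R p) + \<bar>s\<bar> + \<bar>h x - s * \<epsilon>\<bar>"
      using adjoin_attained by blast
    have "adjoin P p h \<epsilon> (c *\<^sub>R x) \<le>
        P (c *\<^sub>R x - (c * s) *\<^sub>R p) + \<bar>c * s\<bar> + \<bar>h (c *\<^sub>R x) - (c * s) * \<epsilon>\<bar>" by (rule adjoin_le)
    also have "c *\<^sub>R x - (c * s) *\<^sub>R p = c *\<^sub>R (x - s *\<^sub>R p)" by (simp add: algebra_simps)
    also have "h (c *\<^sub>R x) - (c * s) * \<epsilon> = c * (h x - s * \<epsilon>)"
      using h by (simp add: linear_scale algebra_simps)
    also have "P (c *\<^sub>R (x - s *\<^sub>R p)) = \<bar>c\<bar> * P (x - s *\<^sub>R p)" by (rule seminorm_scale[OF P])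
    finally show ?thesis using s by (simp add: abs_mult distrib_left)
  qed
  fix c x
  show "adjoin P p h \<epsilon> (c *\<^sub>R x) = \<bar>c\<bar> * adjoin P p h \<epsilon> x"
  proof (cases "c = 0")
    case True
    have "adjoin P p h \<epsilon> 0 \<le> 0" using adjoin_le[of 0 0] seminorm_0[OF P] linear_0[OF h] by simp
    moreover have "0 \<le> adjoin P p h \<epsilon> 0"
      unfolding adjoin_def by (intro cINF_greatest) (auto intro!: add_nonneg_nonneg seminorm_nonneg[OF P])
    ultimately show ?thesis using True by simp
  next
    case False
    have "adjoin P p h \<epsilon> ((1 / c) *\<^sub>R (c *\<^sub>R x)) \<le> \<bar>1 / c\<bar> * adjoin P p h \<epsilon> (c *\<^sub>R x)" by (rule le)
    then have "\<bar>c\<bar> * adjoin P p h \<epsilon> x \<le> adjoin P p h \<epsilon> (c *\<^sub>R x)" using False by (simp add: field_simps)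
    then show ?thesis using le[of c x] by simp
  qed
qed

text \<open>Because \<open>P p \<le> 1\<close>, the new vertices project into the old ball, so the projection along \<open>e\<close> does not
  increase the norm.\<close>

lemma le_adjoin: "P x \<le> adjoin P p h \<epsilon> x"
proof -
  obtain s where s: "adjoin P p h \<epsilon> x = P (x - s *\<^sub>R p) + \<bar>s\<bar> + \<bar>h x - s * \<epsilon>\<bar>"
    using adjoin_attained by blast
  have "P x \<le> P (x - s *\<^sub>R p) + \<bar>s\<bar> * P p"
    using seminorm_add[OF P, of "x - s *\<^sub>R p" "s *\<^sub>R p"] seminorm_scale[OF P, of s p] by simp
  also have "\<bar>s\<bar> * P p \<le> \<bar>s\<bar> * 1" using p by (intro mult_left_mono) auto
  finally show ?thesis using s by simp
qed

lemma adjoin_eq: "h x = 0 \<Longrightarrow> adjoin P p h \<epsilon> x = P x"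
  using le_adjoin[of x] adjoin_le[of x 0] by simp

end

lemma convex_cone_add:
  assumes "convex C" "u \<in> C" "w \<in> C" "a \<ge> 0" "b \<ge> 0"
  shows "\<exists>z\<in>C. a *\<^sub>R u + b *\<^sub>R w = (a + b) *\<^sub>R z"
proof (cases "a + b = 0")
  case True
  then have "a = 0" "b = 0" using assms(4,5) by auto
  then show ?thesis using assms(2) by auto
next
  case False
  have "(a / (a + b)) *\<^sub>R u + (b / (a + b)) *\<^sub>R w \<in> C"
    using assms False by (intro convexD) (auto simp flip: add_divide_distrib)
  moreover have "a *\<^sub>R u + b *\<^sub>R w = (a + b) *\<^sub>R ((a / (a + b)) *\<^sub>R u + (b / (a + b)) *\<^sub>R w)"
    using False by (simp add: scaleR_add_right)
  ultimately show ?thesis by blast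
qed

section \<open>A norm with dense strongly exposed points\<close>

definition eps :: "nat \<Rightarrow> real"
  where "eps m = (1/2) ^ m"

text \<open>Enumerates the finitely supported rational vectors. The second component of the decoded pair is
  ignored, so that every vector occurs for arbitrarily large \<open>m\<close>; the cut at \<open>m\<close> makes the vector
  available in step \<open>m\<close>.\<close>

definition rat_vec :: "nat \<Rightarrow> nat \<Rightarrow> real"
  where "rat_vec m = (let qs = from_nat (fst (prod_decode m)) :: rat list in
    (\<lambda>i. if i < m \<and> i < length qs then of_rat (qs ! i) else 0))"

text \<open>A multiple of the rational vector with norm \<open>1 - \<epsilon>\<^sub>m/2\<close>. If \<open>P\<close> vanishes on the vector, the quotient
  \<open>1/0 = 0\<close> gives the zero vector.\<close>

definition shrunk :: "((nat \<Rightarrow> real) \<Rightarrow> real) \<Rightarrow> nat \<Rightarrow> nat \<Rightarrow> real"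
  where "shrunk P m = (1 - eps m / 2) *\<^sub>R ((1 / P (rat_vec m)) *\<^sub>R rat_vec m)"

text \<open>\<open>pre_norm m\<close> is a seminorm on all sequences that depends on the first \<open>m\<close> coordinates only.\<close>

primrec pre_norm :: "nat \<Rightarrow> (nat \<Rightarrow> real) \<Rightarrow> real" where
  "pre_norm 0 = (\<lambda>x. 0)"
| "pre_norm (Suc m) = adjoin (pre_norm m) (shrunk (pre_norm m) m) (\<lambda>x. x m) (eps m)"

definition centre :: "nat \<Rightarrow> nat \<Rightarrow> real"
  where "centre m = (1 / pre_norm m (rat_vec m)) *\<^sub>R rat_vec m"

definition apex :: "nat \<Rightarrow> nat \<Rightarrow> real"
  where "apex m = (1 - eps m / 2) *\<^sub>R centre m + eps m *\<^sub>R unit_seq m"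

text \<open>On \<open>c00_upto n\<close> all \<open>pre_norm k\<close> with \<open>k \<ge> n\<close> agree, so any index that covers the support would do.\<close>

definition apex_norm :: "(nat \<Rightarrow> real) \<Rightarrow> real"
  where "apex_norm x = pre_norm (LEAST n. x \<in> c00_upto n) x"

primrec vertices :: "nat \<Rightarrow> (nat \<Rightarrow> real) set" where
  "vertices 0 = {0}"
| "vertices (Suc m) = vertices m \<union> {unit_seq m, - unit_seq m, apex m, - apex m}"

lemma eps_bounds: "0 < eps m" "eps m \<le> 1"
  by (auto simp: eps_def power_le_one)

lemma shrunk_eq: "shrunk (pre_norm m) m = (1 - eps m / 2) *\<^sub>R centre m"
  by (simp add: shrunk_def centre_def)

lemma centre_le:
  assumes "seminorm (pre_norm m)" shows "pre_norm m (centre m) \<le> 1"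
  using seminorm_nonneg[OF assms, of "rat_vec m"]
  by (cases "pre_norm m (rat_vec m) = 0") (auto simp: centre_def seminorm_scale[OF assms] seminorm_0[OF assms])

lemma shrunk_le:
  assumes "seminorm (pre_norm m)" shows "pre_norm m (shrunk (pre_norm m) m) \<le> 1"
proof -
  have "pre_norm m (shrunk (pre_norm m) m) = (1 - eps m / 2) * pre_norm m (centre m)"
    using eps_bounds[of m] unfolding shrunk_eq by (simp add: seminorm_scale[OF assms])
  also have "\<dots> \<le> 1 * 1"
    using eps_bounds[of m] centre_le[OF assms] seminorm_nonneg[OF assms] by (intro mult_mono) auto
  finally show ?thesis by simp
qed

lemma seminorm_pre_norm: "seminorm (pre_norm m)"
proof (induction m)
  case 0
  show ?case by (simp add: seminorm_def)
next
  case (Suc m)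
  then show ?case using shrunk_le[OF Suc] by (simp add: seminorm_adjoin linear_eval)
qed

lemmas pre_norm_add = seminorm_add[OF seminorm_pre_norm]
  and pre_norm_scale = seminorm_scale[OF seminorm_pre_norm]
  and pre_norm_minus = seminorm_minus[OF seminorm_pre_norm]
  and pre_norm_nonneg = seminorm_nonneg[OF seminorm_pre_norm]

lemma pre_norm_Suc_le:
  "pre_norm (Suc m) x \<le> pre_norm m (x - s *\<^sub>R shrunk (pre_norm m) m) + \<bar>s\<bar> + \<bar>x m - s * eps m\<bar>"
  unfolding pre_norm.simps by (intro adjoin_le seminorm_pre_norm shrunk_le linear_eval)

lemma pre_norm_Suc_attained:
  "\<exists>s. pre_norm (Suc m) x
    = pre_norm m (x - s *\<^sub>R shrunk (pre_norm m) m) + \<bar>s\<bar> + \<bar>x m - s * eps m\<bar>"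
  unfolding pre_norm.simps
  by (intro adjoin_attained seminorm_pre_norm shrunk_le linear_eval)

lemma pre_norm_Suc_eq: "x m = 0 \<Longrightarrow> pre_norm (Suc m) x = pre_norm m x"
  unfolding pre_norm.simps
  by (intro adjoin_eq seminorm_pre_norm shrunk_le linear_eval)

lemma centre_in: "centre m \<in> c00_upto m"
  by (auto simp: centre_def rat_vec_def c00_upto_def Let_def)

lemma apex_in: "apex m \<in> c00_upto (Suc m)"
  using centre_in[of m] by (auto simp: apex_def c00_upto_def)

lemma pre_norm_null: "(\<And>k. k < m \<Longrightarrow> z k = 0) \<Longrightarrow> pre_norm m z = 0"
  by (induction m) (simp_all add: pre_norm_Suc_eq del: pre_norm.simps(2))

lemma pre_norm_stable: "\<lbrakk>x \<in> c00_upto n; n \<le> k\<rbrakk> \<Longrightarrow> pre_norm k x = pre_norm n x"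
proof (induction k)
  case (Suc k)
  show ?case
  proof (cases "n \<le> k")
    case True
    then show ?thesis using Suc by (simp add: c00_upto_def pre_norm_Suc_eq del: pre_norm.simps)
  next
    case False
    then have "n = Suc k" using Suc.prems by simp
    then show ?thesis by simp
  qed
qed simp

lemma apex_norm_eq:
  assumes "x \<in> c00_upto n"
  shows "apex_norm x = pre_norm n x"
proof -
  let ?l = "LEAST n. x \<in> c00_upto n"
  have "x \<in> c00_upto ?l" by (rule LeastI, rule assms)
  moreover have "?l \<le> n" by (rule Least_le, rule assms)
  ultimately show ?thesis unfolding apex_norm_def by (rule pre_norm_stable[symmetric])
qed

lemma pre_norm_le_l1: "pre_norm m x \<le> (\<Sum>k<m. \<bar>x k\<bar>)"
proof (induction m)
  case (Suc m)
  show ?case using pre_norm_Suc_le[of m x 0] Suc by (simp del: pre_norm.simps)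
qed simp

lemma abs_last_le_pre_norm: "\<bar>x m\<bar> \<le> pre_norm (Suc m) x"
proof -
  obtain s where s: "pre_norm (Suc m) x =
      pre_norm m (x - s *\<^sub>R shrunk (pre_norm m) m) + \<bar>s\<bar> + \<bar>x m - s * eps m\<bar>"
    using pre_norm_Suc_attained by blast
  have "\<bar>x m\<bar> \<le> \<bar>x m - s * eps m\<bar> + \<bar>s * eps m\<bar>" by linarith
  also have "\<bar>s * eps m\<bar> \<le> \<bar>s\<bar>" using eps_bounds[of m] by (simp add: abs_mult mult_left_le)
  finally show ?thesis using s pre_norm_nonneg[of m "x - s *\<^sub>R shrunk (pre_norm m) m"] by linarith
qed

lemma pre_norm_unit_seq: "pre_norm (Suc m) (unit_seq m) \<le> 1"
  using pre_norm_le_l1[of "Suc m" "unit_seq m"] by simp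

lemma pre_norm_apex: "pre_norm (Suc m) (apex m) \<le> 1"
proof -
  have "pre_norm (Suc m) (apex m) \<le>
    pre_norm m (apex m - 1 *\<^sub>R shrunk (pre_norm m) m) + \<bar>1\<bar> + \<bar>apex m m - 1 * eps m\<bar>"
    by (rule pre_norm_Suc_le)
  also have "apex m - 1 *\<^sub>R shrunk (pre_norm m) m = eps m *\<^sub>R unit_seq m"
    by (simp add: apex_def shrunk_eq)
  also have "pre_norm m (eps m *\<^sub>R unit_seq m) = 0" by (rule pre_norm_null) simp
  also have "apex m m = eps m" using centre_in[of m] by (simp add: apex_def c00_upto_def)
  finally show ?thesis by simp
qed

lemma finite_vertices: "finite (vertices m)"
  by (induction m) auto

lemma vertices_in: "vertices m \<subseteq> {x \<in> c00_upto m. pre_norm m x \<le> 1}"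
proof (induction m)
  case 0
  show ?case by (simp add: c00_upto_def)
next
  case (Suc m)
  have "vertices m \<subseteq> {x \<in> c00_upto (Suc m). pre_norm (Suc m) x \<le> 1}"
    using Suc c00_upto_mono[of m "Suc m"] pre_norm_stable[of _ m "Suc m"] by fastforce
  moreover have "unit_seq m \<in> c00_upto (Suc m)" by simp
  ultimately show ?case
    using pre_norm_unit_seq[of m] pre_norm_apex[of m] apex_in[of m] pre_norm_minus[of "Suc m"]
      subspace_neg[OF subspace_c00_upto]
    by (auto simp del: pre_norm.simps)
qed

lemma zero_in_hull_vertices: "0 \<in> convex hull vertices m"
proof -
  have "0 \<in> vertices m" by (induction m) auto
  then show ?thesis by (rule hull_inc)
qed

text \<open>The minimizing coefficient \<open>s\<close> splits \<open>x\<close> into multiples of a point of the smaller hull, of the new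
  apex and of the new unit vector whose factors add up to the norm of \<open>x\<close>.\<close>

lemma pre_norm_decomposition:
  "x \<in> c00_upto m \<Longrightarrow> \<exists>u\<in>convex hull vertices m. x = pre_norm m x *\<^sub>R u"
proof (induction m arbitrary: x)
  case 0
  then have "x = 0" by (auto simp: c00_upto_def)
  then show ?case using zero_in_hull_vertices[of 0] by auto
next
  case (Suc m)
  let ?C = "convex hull vertices (Suc m)" and ?p = "shrunk (pre_norm m) m"
  obtain s where s: "pre_norm (Suc m) x = pre_norm m (x - s *\<^sub>R ?p) + \<bar>s\<bar> + \<bar>x m - s * eps m\<bar>"
    using pre_norm_Suc_attained by blast
  define y where "y = x - s *\<^sub>R ?p - x m *\<^sub>R unit_seq m"
  have y: "y \<in> c00_upto m"
    unfolding c00_upto_def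
  proof (intro CollectI allI impI)
    fix k assume "m \<le> k"
    then show "y k = 0"
      using Suc.prems centre_in[of m] by (cases "k = m") (auto simp: y_def shrunk_eq c00_upto_def)
  qed
  have "pre_norm m (- x m *\<^sub>R unit_seq m) = 0" by (rule pre_norm_null) simp
  then have yn: "pre_norm m y = pre_norm m (x - s *\<^sub>R ?p)"
    using seminorm_add_null[OF seminorm_pre_norm, of m "- x m *\<^sub>R unit_seq m" "x - s *\<^sub>R ?p"]
    by (simp add: y_def)
  obtain u where u: "u \<in> convex hull vertices m" "y = pre_norm m y *\<^sub>R u"
    using Suc.IH[OF y] by blast
  have sub: "convex hull vertices m \<subseteq> ?C" by (rule hull_mono) auto
  have signed: "\<exists>w\<in>?C. t *\<^sub>R z = \<bar>t\<bar> *\<^sub>R w"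
    if "z \<in> vertices (Suc m)" "- z \<in> vertices (Suc m)" for t z
  proof (cases "t \<ge> 0")
    case True
    then show ?thesis using that(1) by (intro bexI[of _ z] hull_inc) auto
  next
    case False
    then show ?thesis using that(2) by (intro bexI[of _ "- z"] hull_inc) auto
  qed
  obtain v where v: "v \<in> ?C" "s *\<^sub>R apex m = \<bar>s\<bar> *\<^sub>R v" using signed[of "apex m" s] by auto
  obtain w where w: "w \<in> ?C" "(x m - s * eps m) *\<^sub>R unit_seq m = \<bar>x m - s * eps m\<bar> *\<^sub>R w"
    using signed[of "unit_seq m" "x m - s * eps m"] by auto
  obtain z where z: "z \<in> ?C" "pre_norm m y *\<^sub>R u + \<bar>s\<bar> *\<^sub>R v = (pre_norm m y + \<bar>s\<bar>) *\<^sub>R z"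
    using convex_cone_add[of ?C u v "pre_norm m y" "\<bar>s\<bar>"] sub u(1) v(1) pre_norm_nonneg by auto
  have "\<exists>z'\<in>?C. (pre_norm m y + \<bar>s\<bar>) *\<^sub>R z + \<bar>x m - s * eps m\<bar> *\<^sub>R w
      = (pre_norm m y + \<bar>s\<bar> + \<bar>x m - s * eps m\<bar>) *\<^sub>R z'"
    using z(1) w(1) pre_norm_nonneg by (intro convex_cone_add) auto
  moreover have "x = y + s *\<^sub>R apex m + (x m - s * eps m) *\<^sub>R unit_seq m"
    by (simp add: y_def apex_def shrunk_eq algebra_simps)
  ultimately show ?case
    unfolding s yn[symmetric] using u(2) v(2) w(2) z(2) by metis
qed

lemma ball_eq_hull_vertices: "{x \<in> c00_upto m. pre_norm m x \<le> 1} = convex hull vertices m"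
proof (intro equalityI subsetI)
  fix x assume x: "x \<in> {x \<in> c00_upto m. pre_norm m x \<le> 1}"
  then obtain u where u: "u \<in> convex hull vertices m" "x = pre_norm m x *\<^sub>R u"
    using pre_norm_decomposition by blast
  have "pre_norm m x *\<^sub>R u + (1 - pre_norm m x) *\<^sub>R 0 \<in> convex hull vertices m"
    using x u(1) zero_in_hull_vertices pre_norm_nonneg by (intro convexD[OF convex_convex_hull]) auto
  then show "x \<in> convex hull vertices m" using u(2) by simp
next
  have "convex {x \<in> c00_upto m. pre_norm m x \<le> 1}"
  proof (rule convexI)
    fix x y and s t :: real
    assume xy: "x \<in> {x \<in> c00_upto m. pre_norm m x \<le> 1}" "y \<in> {x \<in> c00_upto m. pre_norm m x \<le> 1}"
      and st: "0 \<le> s" "0 \<le> t" "s + t = 1"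
    have "pre_norm m (s *\<^sub>R x + t *\<^sub>R y) \<le> s * pre_norm m x + t * pre_norm m y"
      using pre_norm_add[of m "s *\<^sub>R x" "t *\<^sub>R y"] st by (simp add: pre_norm_scale)
    also have "\<dots> \<le> 1" using xy st by (intro convex_bound_le) auto
    finally show "s *\<^sub>R x + t *\<^sub>R y \<in> {x \<in> c00_upto m. pre_norm m x \<le> 1}"
      using xy subspace_add[OF subspace_c00_upto] subspace_scale[OF subspace_c00_upto] by auto
  qed
  then have "convex hull vertices m \<subseteq> {x \<in> c00_upto m. pre_norm m x \<le> 1}"
    using vertices_in by (intro hull_minimal)
  then show "x \<in> convex hull vertices m \<Longrightarrow> x \<in> {x \<in> c00_upto m. pre_norm m x \<le> 1}" for x by blast
qed

interpretation apex: normed_space c00 apex_norm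
proof
  show "subspace c00" by (rule subspace_c00)
next
  fix x assume "x \<in> c00"
  then obtain n where n: "x \<in> c00_upto n" by (rule c00_uptoE)
  show "apex_norm x = 0 \<longleftrightarrow> x = 0"
  proof
    assume "apex_norm x = 0"
    then show "x = 0" using pre_norm_decomposition[OF n] by (auto simp: apex_norm_eq[OF n])
  qed (use apex_norm_eq[OF n] seminorm_0[OF seminorm_pre_norm] in simp)
  show "apex_norm (c *\<^sub>R x) = \<bar>c\<bar> * apex_norm x" for c
    using apex_norm_eq[OF n] apex_norm_eq[OF subspace_scale[OF subspace_c00_upto n]]
    by (simp add: pre_norm_scale)
next
  fix x y assume "x \<in> c00" "y \<in> c00"
  then obtain n where n: "x \<in> c00_upto n" "y \<in> c00_upto n" by (rule c00_uptoE2)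
  then show "apex_norm (x + y) \<le> apex_norm x + apex_norm y"
    using apex_norm_eq[OF n(1)] apex_norm_eq[OF n(2)] apex_norm_eq[OF subspace_add[OF subspace_c00_upto n]]
    by (simp add: pre_norm_add)
qed

text \<open>The ball of a finite-dimensional subspace is the section of some hull of \<open>vertices n\<close>.\<close>

lemma K_polyhedral_apex: "K_polyhedral c00 apex_norm"
  unfolding K_polyhedral_def
proof (intro allI impI)
  fix W assume W: "subspace W \<and> W \<subseteq> c00 \<and> (\<exists>B. finite B \<and> span B = W)"
  then obtain B where B: "finite B" "span B = W" by blast
  then have "B \<subseteq> (\<Union>n. c00_upto n)" using W span_superset by (force simp: c00_def)
  then obtain n where n: "W \<subseteq> c00_upto n"
    using finite_span_subset_chain[of c00_upto, OF subspace_c00_upto c00_upto_mono B(1)] B(2)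
    by blast
  have "unit_ball W apex_norm = {x \<in> c00_upto n. pre_norm n x \<le> 1} \<inter> W"
    using n apex_norm_eq[of _ n] by (auto simp: unit_ball_def)
  moreover have "polytope (convex hull vertices n)" using finite_vertices by (auto simp: polytope_def)
  ultimately show "polytope (unit_ball W apex_norm)"
    using W by (simp add: ball_eq_hull_vertices polytope_Int_subspace)
qed

text \<open>The functional that exposes \<open>apex n\<close> when \<open>g\<close> supports the ball of \<open>pre_norm n\<close> at \<open>centre n\<close>.
  The denominator normalizes its value at \<open>apex n\<close>, which is \<open>(1 - \<epsilon>\<^sub>n/2) + \<epsilon>\<^sub>n\<close> before.\<close>

definition expose :: "((nat \<Rightarrow> real) \<Rightarrow> real) \<Rightarrow> nat \<Rightarrow> (nat \<Rightarrow> real) \<Rightarrow> real"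
  where "expose g n x = (g x + x n) / (1 + eps n / 2)"

context
  fixes n :: nat and g :: "(nat \<Rightarrow> real) \<Rightarrow> real"
  assumes lin: "linear g" and g_le: "\<And>x. \<bar>g x\<bar> \<le> pre_norm n x" and g_centre: "g (centre n) = 1"
begin

lemma g_null: "(\<And>k. k < n \<Longrightarrow> z k = 0) \<Longrightarrow> g z = 0"
  using g_le[of z] pre_norm_null[of n z] by simp

lemma linear_expose: "linear (expose g n)"
  using lin by (intro linearI) (auto simp: expose_def linear_add linear_scale add_divide_distrib distrib_left)

lemma expose_apex: "expose g n (apex n) = 1"
proof -
  have "g (unit_seq n) = 0" by (rule g_null) simp
  moreover have "apex n n = eps n" using centre_in[of n] by (simp add: apex_def c00_upto_def)
  ultimately show ?thesis
    using lin g_centre eps_bounds[of n] by (simp add: expose_def apex_def linear_add linear_scale)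
qed

lemma bound_on_hull:
  assumes q: "q \<in> convex hull vertices m"
    and bound: "\<And>a. a \<in> vertices m \<Longrightarrow> apex_norm (a - apex n) \<le> C * (1 - expose g n a)"
  shows "apex_norm (q - apex n) \<le> C * (1 - expose g n q)"
proof -
  let ?v = "apex n" and ?f = "expose g n"
  have v: "?v \<in> c00" using apex_in[of n] c00_upto_subset by blast
  have "convex {q \<in> c00. apex_norm (q - ?v) \<le> C * (1 - ?f q)}"
  proof (rule convexI)
    fix x y and s t :: real
    assume x: "x \<in> {q \<in> c00. apex_norm (q - ?v) \<le> C * (1 - ?f q)}"
      and y: "y \<in> {q \<in> c00. apex_norm (q - ?v) \<le> C * (1 - ?f q)}"
      and st: "0 \<le> s" "0 \<le> t" "s + t = 1"
    have s: "s = 1 - t" using st by simp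
    have diff: "x - ?v \<in> c00" "y - ?v \<in> c00" using x y v subspace_diff[OF subspace_c00] by auto
    have "s *\<^sub>R x + t *\<^sub>R y - ?v = s *\<^sub>R (x - ?v) + t *\<^sub>R (y - ?v)"
      by (simp add: s algebra_simps)
    then have "apex_norm (s *\<^sub>R x + t *\<^sub>R y - ?v) \<le> s * apex_norm (x - ?v) + t * apex_norm (y - ?v)"
      using apex.norm_triangle[of "s *\<^sub>R (x - ?v)" "t *\<^sub>R (y - ?v)"] diff
        subspace_scale[OF subspace_c00] apex.norm_scaleR st by simp
    also have "\<dots> \<le> s * (C * (1 - ?f x)) + t * (C * (1 - ?f y))"
      using x y st by (intro add_mono mult_left_mono) auto
    also have "\<dots> = C * (1 - ?f (s *\<^sub>R x + t *\<^sub>R y))"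
    proof -
      have "s * (c * (1 - a)) + t * (c * (1 - b)) = c * (1 - (s * a + t * b))" for a b c :: real
        by (simp add: s algebra_simps)
      then show ?thesis using linear_expose by (simp add: linear_add linear_scale)
    qed
    finally show "s *\<^sub>R x + t *\<^sub>R y \<in> {q \<in> c00. apex_norm (q - ?v) \<le> C * (1 - ?f q)}"
      using x y subspace_add[OF subspace_c00] subspace_scale[OF subspace_c00] by auto
  qed
  moreover have "vertices m \<subseteq> {q \<in> c00. apex_norm (q - ?v) \<le> C * (1 - ?f q)}"
    using bound vertices_in[of m] c00_upto_subset by blast
  ultimately have "convex hull vertices m \<subseteq> {q \<in> c00. apex_norm (q - ?v) \<le> C * (1 - ?f q)}"
    by (intro hull_minimal)
  then show ?thesis using q by blast
qed

text \<open>The constant comes from step \<open>n\<close>: all other vertices present then have value at most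
  \<open>1 / (1 + \<epsilon>\<^sub>n/2)\<close> and distance at most \<open>2\<close>. A later apex is \<open>(1 - \<delta>) q + 2\<delta> e\<^sub>m\<close> up to sign, with
  \<open>q\<close> in the hull of the earlier vertices. Compared with \<open>q\<close>, the left-hand side grows by at most
  \<open>3\<delta>\<close> beyond the factor \<open>1 - \<delta>\<close>, and the right-hand side by \<open>C \<delta>\<close>. As \<open>C \<ge> 3\<close>, the same constant
  works for ever.\<close>

lemma vertices_bound:
  assumes "Suc n \<le> m" "a \<in> vertices m"
  shows "apex_norm (a - apex n) \<le> 6 / eps n * (1 - expose g n a)"
  using assms
proof (induction m arbitrary: a rule: dec_induct)
  note e = eps_bounds[of n]
  case base
  then have a: "a \<in> {x \<in> c00_upto (Suc n). pre_norm (Suc n) x \<le> 1}" using vertices_in by blast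
  show ?case
  proof (cases "a = apex n")
    case True
    then show ?thesis by (simp add: expose_apex flip: zero_fun_def)
  next
    case False
    have "pre_norm (Suc n) (a - apex n) \<le> 2"
      using pre_norm_add[of "Suc n" a "- apex n"] a pre_norm_apex[of n] pre_norm_minus[of "Suc n" "apex n"]
      by simp
    moreover have "a - apex n \<in> c00_upto (Suc n)"
      using a apex_in subspace_diff[OF subspace_c00_upto] by blast
    ultimately have 2: "apex_norm (a - apex n) \<le> 2" by (simp add: apex_norm_eq)
    have "g a + a n \<le> 1"
    proof -
      have "g a + a n \<le> 1" if "a \<in> vertices n"
        using that vertices_in[of n] g_le[of a] by (auto simp: c00_upto_def)
      moreover have "g (unit_seq n) = 0" by (rule g_null) simp
      moreover have "g (- apex n) + (- apex n) n = - (1 + eps n / 2)"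
        using expose_apex e lin by (simp add: expose_def linear_neg field_simps)
      ultimately show ?thesis
        using base False e lin by (auto simp: linear_neg)
    qed
    then have "expose g n a \<le> 1 / (1 + eps n / 2)"
      using e by (simp add: expose_def divide_right_mono)
    then have "1 - expose g n a \<ge> 1 - 1 / (1 + eps n / 2)" by simp
    also have "1 - 1 / (1 + eps n / 2) = (eps n / 2) / (1 + eps n / 2)" using e by (simp add: field_simps)
    finally have "6 / eps n * ((eps n / 2) / (1 + eps n / 2)) \<le> 6 / eps n * (1 - expose g n a)"
      using e by (intro mult_left_mono) auto
    moreover have "2 \<le> 6 / eps n * ((eps n / 2) / (1 + eps n / 2))" using e by (simp add: field_simps)
    ultimately show ?thesis using 2 by linarith
  qed
next
  case (step m)
  note e = eps_bounds[of n]
  let ?v = "apex n" and ?f = "expose g n" and ?C = "6 / eps n"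
  have C: "?C \<ge> 6" using e by (simp add: field_simps)
  have n: "n < m" using step.hyps by simp
  have v: "?v \<in> c00" "apex_norm ?v \<le> 1"
    using apex_in[of n] c00_upto_subset pre_norm_apex[of n] by (auto simp: apex_norm_eq)
  have norm_e: "apex_norm (unit_seq m) \<le> 1"
    using pre_norm_unit_seq[of m] apex_norm_eq[of "unit_seq m" "Suc m"] by simp
  have fe: "?f (unit_seq m) = 0" using n by (simp add: expose_def g_null)
  have hull: "apex_norm (q - ?v) \<le> ?C * (1 - ?f q)" if "q \<in> convex hull vertices m" for q
    using that step.IH by (rule bound_on_hull)
  have unit: "apex_norm (c *\<^sub>R unit_seq m - ?v) \<le> ?C * (1 - ?f (c *\<^sub>R unit_seq m))" if "\<bar>c\<bar> = 1" for c
  proof -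
    have "apex_norm (c *\<^sub>R unit_seq m - ?v) \<le> apex_norm (c *\<^sub>R unit_seq m) + apex_norm (- ?v)"
      using apex.norm_triangle[of "c *\<^sub>R unit_seq m" "- ?v"] v
        subspace_scale[OF subspace_c00] subspace_neg[OF subspace_c00] by simp
    also have "\<dots> \<le> 2" using v norm_e that by (simp add: apex.norm_scaleR apex.norm_minus)
    finally show ?thesis using C fe linear_expose by (simp add: linear_scale)
  qed
  have apex: "apex_norm (c *\<^sub>R apex m - ?v) \<le> ?C * (1 - ?f (c *\<^sub>R apex m))" if c: "\<bar>c\<bar> = 1" for c
  proof -
    define \<delta> where "\<delta> = eps m / 2"
    have \<delta>: "0 < \<delta>" "\<delta> \<le> 1/2" "eps m = 2 * \<delta>" using eps_bounds[of m] by (auto simp: \<delta>_def)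
    define q where "q = c *\<^sub>R centre m"
    have "q \<in> c00_upto m" "pre_norm m q \<le> 1"
      using centre_in[of m] centre_le[OF seminorm_pre_norm, of m] c subspace_scale[OF subspace_c00_upto]
      by (auto simp: q_def pre_norm_scale)
    then have q: "q \<in> convex hull vertices m" "q \<in> c00"
      using ball_eq_hull_vertices[of m] c00_upto_subset by auto
    have split: "c *\<^sub>R apex m = (1 - \<delta>) *\<^sub>R q + (c * (2 * \<delta>)) *\<^sub>R unit_seq m"
      by (simp add: apex_def q_def \<delta>(3) algebra_simps)
    then have "c *\<^sub>R apex m - ?v = (1 - \<delta>) *\<^sub>R (q - ?v) + ((c * (2 * \<delta>)) *\<^sub>R unit_seq m + (- \<delta>) *\<^sub>R ?v)"
      by (simp add: algebra_simps)
    moreover have mem: "(1 - \<delta>) *\<^sub>R (q - ?v) \<in> c00" "(c * (2 * \<delta>)) *\<^sub>R unit_seq m \<in> c00" "(- \<delta>) *\<^sub>R ?v \<in> c00"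
      "q - ?v \<in> c00"
      using q(2) v(1) subspace_scale[OF subspace_c00] subspace_diff[OF subspace_c00]
        unit_seq_in_c00 by blast+
    ultimately have "apex_norm (c *\<^sub>R apex m - ?v) \<le> apex_norm ((1 - \<delta>) *\<^sub>R (q - ?v))
        + (apex_norm ((c * (2 * \<delta>)) *\<^sub>R unit_seq m) + apex_norm ((- \<delta>) *\<^sub>R ?v))"
      using apex.norm_triangle[OF mem(1) subspace_add[OF subspace_c00 mem(2,3)]]
        apex.norm_triangle[OF mem(2,3)] by simp
    also have "\<dots> = (1 - \<delta>) * apex_norm (q - ?v) + (2 * \<delta> * apex_norm (unit_seq m) + \<delta> * apex_norm ?v)"
      using \<delta> c v(1) mem(4) apex.norm_scaleR[OF mem(4), of "1 - \<delta>"]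
        apex.norm_scaleR[OF unit_seq_in_c00, of "c * (2 * \<delta>)" m] apex.norm_scaleR[OF v(1), of "- \<delta>"]
      by (simp add: abs_mult)
    also have "\<dots> \<le> (1 - \<delta>) * (?C * (1 - ?f q)) + (2 * \<delta> * 1 + \<delta> * 1)"
      using hull[OF q(1)] norm_e v(2) \<delta> by (intro add_mono mult_left_mono) auto
    also have "2 * \<delta> * 1 + \<delta> * 1 \<le> ?C * \<delta>" using C \<delta>(1) mult_right_mono[OF C, of \<delta>] by linarith
    also have "(1 - \<delta>) * (?C * (1 - ?f q)) + ?C * \<delta> = ?C * (1 - (1 - \<delta>) * ?f q)"
    proof -
      have "(1 - \<delta>) * (c * (1 - a)) + c * \<delta> = c * (1 - (1 - \<delta>) * a)" for a c :: real
        by (simp add: algebra_simps)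
      then show ?thesis .
    qed
    also have "(1 - \<delta>) * ?f q = ?f (c *\<^sub>R apex m)"
      unfolding split using linear_expose fe by (simp add: linear_add linear_scale)
    finally show ?thesis by this (rule add_left_mono)
  qed
  from step.prems consider "a \<in> vertices m" | "a = 1 *\<^sub>R unit_seq m" | "a = (-1) *\<^sub>R unit_seq m"
    | "a = 1 *\<^sub>R apex m" | "a = (-1) *\<^sub>R apex m" by auto
  then show ?case
  proof cases
    case 1
    then show ?thesis by (rule step.IH)
  next
    case 2
    show ?thesis unfolding 2 by (rule unit) simp
  next
    case 3
    show ?thesis unfolding 3 by (rule unit) simp
  next
    case 4
    show ?thesis unfolding 4 by (rule apex) simp
  next
    case 5
    show ?thesis unfolding 5 by (rule apex) simp
  qed
qed

lemma apex_strongly_exposed: "apex n \<in> strongly_exposed_points c00 apex_norm (unit_ball c00 apex_norm)"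
proof (rule apex.strongly_exposedI)
  let ?f = "\<lambda>x. if x \<in> c00 then expose g n x else 0"
  have v: "apex n \<in> c00" "apex_norm (apex n) \<le> 1"
    using apex_in[of n] c00_upto_subset pre_norm_apex[of n] by (auto simp: apex_norm_eq)
  then show "apex n \<in> unit_ball c00 apex_norm" by (simp add: unit_ball_def)
  show "6 / eps n > 0" using eps_bounds by simp
  have "\<bar>expose g n x\<bar> \<le> 2 * apex_norm x" if x: "x \<in> c00" for x
  proof -
    obtain k where k: "x \<in> c00_upto k" using x by (rule c00_uptoE)
    define m where "m = max k (Suc n)"
    have m: "x \<in> c00_upto m" "Suc n \<le> m" using k c00_upto_mono[of k m] by (auto simp: m_def)
    have mono: "pre_norm i x \<le> pre_norm (Suc i) x" for i
      unfolding pre_norm.simps by (intro le_adjoin seminorm_pre_norm shrunk_le linear_eval)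
    have "pre_norm n x \<le> apex_norm x" "pre_norm (Suc n) x \<le> apex_norm x"
      unfolding apex_norm_eq[OF m(1)] using m(2) by (auto intro!: lift_Suc_mono_le[of "\<lambda>i. pre_norm i x"] mono simp del: pre_norm.simps)
    then have "\<bar>g x + x n\<bar> \<le> 2 * apex_norm x"
      using g_le[of x] abs_last_le_pre_norm[of x n] by linarith
    moreover have "\<bar>expose g n x\<bar> \<le> \<bar>g x + x n\<bar>"
      using eps_bounds[of n] by (simp add: expose_def divide_le_eq distrib_left)
    ultimately show ?thesis by linarith
  qed
  then show "?f \<in> topological_dual c00 apex_norm"
    using linear_expose subspace_add[OF subspace_c00] subspace_scale[OF subspace_c00]
    unfolding topological_dual_def by (auto simp: linear_add linear_scale)
  fix y assume "y \<in> unit_ball c00 apex_norm"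
  then have y: "y \<in> c00" "apex_norm y \<le> 1" by (auto simp: unit_ball_def)
  obtain k where k: "y \<in> c00_upto k" using y(1) by (rule c00_uptoE)
  define m where "m = max k (Suc n)"
  have m: "y \<in> c00_upto m" "Suc n \<le> m" using k c00_upto_mono[of k m] by (auto simp: m_def)
  have "y \<in> convex hull vertices m"
    using m(1) y(2) apex_norm_eq[OF m(1)] ball_eq_hull_vertices[of m] by auto
  then show "apex_norm (y - apex n) \<le> 6 / eps n * (?f (apex n) - ?f y)"
    using bound_on_hull[OF _ vertices_bound[OF m(2)], of y] y(1) v(1) expose_apex by simp
qed

end

lemma apex_strongly_exposed_if:
  assumes "pre_norm n (rat_vec n) \<noteq> 0"
  shows "apex n \<in> strongly_exposed_points c00 apex_norm (unit_ball c00 apex_norm)"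
proof -
  have "\<exists>y\<in>span (unit_seq ` {..<n}). pre_norm n (x - y) = 0" for x
  proof (intro bexI)
    let ?y = "\<Sum>k<n. x k *\<^sub>R unit_seq k"
    have "?y k = x k" if "k < n" for k
    proof -
      have "?y k = (\<Sum>i<n. if k = i then x i else 0)" unfolding sum_fun_apply by (rule sum.cong) auto
      then show ?thesis using that by simp
    qed
    then show "pre_norm n (x - ?y) = 0" by (intro pre_norm_null) simp
    show "?y \<in> span (unit_seq ` {..<n})" by (intro span_sum span_scale span_base) auto
  qed
  then obtain g where g: "linear g" "\<And>x. \<bar>g x\<bar> \<le> pre_norm n x" "g (centre n) = pre_norm n (centre n)"
    using seminorm_support_functional[OF seminorm_pre_norm, of "unit_seq ` {..<n}" n "centre n"] by auto
  moreover have "pre_norm n (centre n) = 1"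
    using assms pre_norm_nonneg[of n "rat_vec n"] by (simp add: centre_def pre_norm_scale)
  ultimately show ?thesis using apex_strongly_exposed[OF g(1,2)] by simp
qed

text \<open>Beyond \<open>k\<close>, so that \<open>\<epsilon>\<^sub>m\<close> can be made small as well.\<close>

lemma rat_vec_approximates:
  assumes x: "x \<in> c00_upto n" and "\<delta> > 0"
  obtains m where "m \<ge> k" "rat_vec m \<in> c00_upto n" "\<And>i. \<bar>rat_vec m i - x i\<bar> \<le> \<delta>"
proof -
  have "\<exists>q. \<bar>of_rat q - x i\<bar> \<le> \<delta>" for i
  proof -
    obtain r where "r \<in> \<rat>" "x i - \<delta> < r" "r < x i + \<delta>"
      using Rats_dense_in_real[of "x i - \<delta>" "x i + \<delta>"] \<open>\<delta> > 0\<close> by auto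
    moreover from this(1) obtain p where "r = of_rat p" by (auto simp: Rats_def)
    ultimately show ?thesis by (intro exI[of _ p]) (simp add: abs_le_iff)
  qed
  then obtain q where q: "\<And>i. \<bar>of_rat (q i) - x i\<bar> \<le> \<delta>" by metis
  define l where "l = map q [0..<n]"
  \<comment> \<open>The second component pushes \<open>m\<close> beyond \<open>k\<close> and beyond the support.\<close>
  define m where "m = prod_encode (to_nat l, max n k)"
  have m: "m \<ge> n" "m \<ge> k" using le_prod_encode_2[of "max n k" "to_nat l"] by (auto simp: m_def)
  have eq: "rat_vec m = (\<lambda>i. if i < n then of_rat (q i) else 0)"
    using m by (auto simp: rat_vec_def m_def l_def fun_eq_iff Let_def)
  show thesis
  proof (rule that[OF m(2)])
    show "rat_vec m \<in> c00_upto n" by (simp add: eq c00_upto_def)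
    show "\<bar>rat_vec m i - x i\<bar> \<le> \<delta>" for i
      using q[of i] x \<open>\<delta> > 0\<close> by (simp add: eq c00_upto_def)
  qed
qed

text \<open>A rational vector \<open>r\<close> close to \<open>x\<close> has norm close to \<open>1\<close>, hence \<open>centre m\<close> is close to \<open>r\<close>, and
  \<open>apex m\<close> differs from \<open>centre m\<close> by at most \<open>3\<epsilon>\<^sub>m/2\<close>.\<close>

lemma strongly_exposed_dense_apex:
  "unit_sphere c00 apex_norm \<subseteq>
    norm_topology c00 apex_norm closure_of strongly_exposed_points c00 apex_norm (unit_ball c00 apex_norm)"
proof
  note sub = subspace_c00
  fix x assume "x \<in> unit_sphere c00 apex_norm"
  then have x: "x \<in> c00" "apex_norm x = 1" by (auto simp: unit_sphere_def)
  obtain n where n: "x \<in> c00_upto n" using x(1) by (rule c00_uptoE)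
  have "\<exists>y\<in>strongly_exposed_points c00 apex_norm (unit_ball c00 apex_norm). apex_norm (y - x) < \<rho>"
    if \<rho>: "\<rho> > 0" for \<rho>
  proof -
    define \<delta> where "\<delta> = min (1/2) (\<rho> / 8)"
    have \<delta>: "\<delta> > 0" "\<delta> \<le> 1/2" "\<delta> \<le> \<rho> / 8" using \<rho> by (auto simp: \<delta>_def)
    obtain k :: nat where k: "(1/2) ^ k < \<rho> / 4"
      using real_arch_pow_inv[of "\<rho> / 4" "1/2"] \<rho> by auto
    have "\<delta> / (real n + 1) > 0" using \<delta>(1) by simp
    then obtain m where m: "m \<ge> k + n" "rat_vec m \<in> c00_upto n"
        "\<And>i. \<bar>rat_vec m i - x i\<bar> \<le> \<delta> / (real n + 1)"
      using rat_vec_approximates[OF n, where k = "k + n"] by blast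
    have "eps m \<le> (1/2) ^ k" unfolding eps_def using m(1) by (intro power_decreasing) auto
    then have eps: "eps m < \<rho> / 4" using k by simp
    let ?r = "rat_vec m"
    have r: "?r \<in> c00" "?r \<in> c00_upto m"
      using m(1,2) c00_upto_subset c00_upto_mono[of n m] by auto
    have "?r - x \<in> c00_upto n" using m(2) n subspace_diff[OF subspace_c00_upto] by blast
    then have "apex_norm (?r - x) \<le> (\<Sum>i<n. \<bar>(?r - x) i\<bar>)" by (simp add: apex_norm_eq pre_norm_le_l1 del: minus_apply)
    also have "\<dots> \<le> (\<Sum>i<n. \<delta> / (real n + 1))" using m(3) by (intro sum_mono) simp
    also have "\<dots> \<le> \<delta>" using \<delta>(1) by (simp add: field_simps)
    finally have rx: "apex_norm (?r - x) \<le> \<delta>" .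
    have abs: "\<bar>apex_norm ?r - 1\<bar> \<le> \<delta>"
      using apex.norm_diff_triangle[OF r(1) x(1) subspace_0[OF sub]]
        apex.norm_diff_triangle[OF x(1) r(1) subspace_0[OF sub]] apex.norm_diff_commute[OF x(1) r(1)] rx x(2)
      by simp
    then have r_pos: "apex_norm ?r \<ge> 1/2" using \<delta>(2) by linarith
    have eq: "pre_norm m ?r = apex_norm ?r" using apex_norm_eq[OF r(2)] by simp
    have c: "centre m \<in> c00" "apex m \<in> c00" using centre_in apex_in c00_upto_subset by blast+
    have cn: "apex_norm (centre m) \<le> 1"
      using centre_le[OF seminorm_pre_norm] apex_norm_eq[OF centre_in] by simp
    have en: "apex_norm (unit_seq m) \<le> 1"
      using pre_norm_unit_seq[of m] apex_norm_eq[of "unit_seq m" "Suc m"] by simp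
    have "centre m - ?r = (1 / apex_norm ?r - 1) *\<^sub>R ?r" by (simp add: centre_def eq algebra_simps)
    then have "apex_norm (centre m - ?r) = \<bar>1 / apex_norm ?r - 1\<bar> * apex_norm ?r"
      by (simp only: apex.norm_scaleR[OF r(1)])
    also have "\<dots> = \<bar>(1 / apex_norm ?r - 1) * apex_norm ?r\<bar>" using r_pos by (simp add: abs_mult)
    also have "(1 / apex_norm ?r - 1) * apex_norm ?r = 1 - apex_norm ?r" using r_pos by (simp add: field_simps)
    finally have cr: "apex_norm (centre m - ?r) \<le> \<delta>" using abs by (simp only: abs_minus_commute)
    have e: "eps m *\<^sub>R unit_seq m \<in> c00" "(- (eps m / 2)) *\<^sub>R centre m \<in> c00"
      using c(1) unit_seq_in_c00 subspace_scale[OF sub] by blast+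
    have "apex m - centre m = eps m *\<^sub>R unit_seq m + (- (eps m / 2)) *\<^sub>R centre m"
      by (simp add: apex_def algebra_simps)
    then have "apex_norm (apex m - centre m) \<le> eps m * apex_norm (unit_seq m) + eps m / 2 * apex_norm (centre m)"
      using apex.norm_triangle[OF e] eps_bounds[of m] apex.norm_scaleR[OF c(1), of "- (eps m / 2)"]
        apex.norm_scaleR[OF unit_seq_in_c00, of "eps m" m] by simp
    also have "\<dots> \<le> eps m * 1 + eps m / 2 * 1"
      using eps_bounds[of m] cn en by (intro add_mono mult_left_mono) auto
    finally have ac: "apex_norm (apex m - centre m) \<le> 3/2 * eps m" by simp
    have "apex_norm (apex m - x) < \<rho>"
      using apex.norm_diff_triangle[OF c(2,1) x(1)] apex.norm_diff_triangle[OF c(1) r(1) x(1)]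
        ac cr rx eps \<delta>(3) \<rho> by linarith
    moreover have "apex m \<in> strongly_exposed_points c00 apex_norm (unit_ball c00 apex_norm)"
      using r_pos eq by (intro apex_strongly_exposed_if) auto
    ultimately show ?thesis by blast
  qed
  moreover have "strongly_exposed_points c00 apex_norm (unit_ball c00 apex_norm) \<subseteq> c00"
    by (auto simp: strongly_exposed_points_def unit_ball_def)
  ultimately show "x \<in> norm_topology c00 apex_norm closure_of
      strongly_exposed_points c00 apex_norm (unit_ball c00 apex_norm)"
    using x(1) by (simp add: apex.in_closure_of_iff)
qed

lemma no_true_faces_apex: "true_faces c00 apex_norm = {}"
proof (rule apex.true_faces_empty_if_strongly_exposed_dense[OF strongly_exposed_dense_apex])
  fix s t :: real assume eq: "s *\<^sub>R unit_seq 0 + t *\<^sub>R unit_seq 1 = 0"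
  show "s = 0 \<and> t = 0" using fun_cong[OF eq, of 0] fun_cong[OF eq, of 1] by simp
qed simp_all

theorem theorem3:
  shows
    "(\<exists>(V :: (nat \<Rightarrow> real) set) N. normed_space V N \<and>
        K_polyhedral V N \<and> property_Delta V N \<and>
        \<not> unit_sphere V N \<subseteq> \<Union> (true_faces V N)) \<and>
     (\<exists>(V :: (nat \<Rightarrow> real) set) N. normed_space V N \<and>
        V_polyhedral V N \<and> algebraic_true_faces V N = {} \<and>
        \<not> unit_sphere V N \<subseteq> \<Union> (true_faces V N)) \<and>
     (\<exists>(V :: (nat \<Rightarrow> real) set) N. normed_space V N \<and>
        K_polyhedral V N \<and>
        unit_sphere V N \<subseteq>
          norm_topology V N closure_of strongly_exposed_points V N (unit_ball V N) \<and>
        \<not> unit_sphere V N \<subseteq> \<Union> (true_faces V N))"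
proof (intro conjI exI)
  have unit: "unit_seq 0 \<noteq> 0" by (metis unit_seq_apply zero_fun_apply zero_neq_one)
  show "normed_space profile_space sup_norm" by (rule sup.normed_space_axioms)
  show "K_polyhedral profile_space sup_norm" by (rule K_polyhedral_sup)
  show "property_Delta profile_space sup_norm" by (rule property_Delta_sup)
  show "\<not> unit_sphere profile_space sup_norm \<subseteq> \<Union> (true_faces profile_space sup_norm)"
    using profile_in_unit_sphere profile_not_in_true_face by blast
  show "normed_space c00 l1_norm" by (rule l1.normed_space_axioms)
  show "V_polyhedral c00 l1_norm" by (rule V_polyhedral_l1)
  show "algebraic_true_faces c00 l1_norm = {}" by (rule no_algebraic_true_faces_l1)
  then show "\<not> unit_sphere c00 l1_norm \<subseteq> \<Union> (true_faces c00 l1_norm)"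
    using l1.true_faces_subset_algebraic l1.unit_sphere_nonempty[OF unit_seq_in_c00 unit] by auto
  show "normed_space c00 apex_norm" by (rule apex.normed_space_axioms)
  show "K_polyhedral c00 apex_norm" by (rule K_polyhedral_apex)
  show "unit_sphere c00 apex_norm \<subseteq>
      norm_topology c00 apex_norm closure_of strongly_exposed_points c00 apex_norm (unit_ball c00 apex_norm)"
    by (rule strongly_exposed_dense_apex)
  show "\<not> unit_sphere c00 apex_norm \<subseteq> \<Union> (true_faces c00 apex_norm)"
    using no_true_faces_apex apex.unit_sphere_nonempty[OF unit_seq_in_c00 unit] by auto
qed

end
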